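(* Let $A\in\mathbb{R}^{n\times n}$ be an invertible matrix, $0<\alpha<n$, $1<p<\infty$ and $\frac1q=\frac1p-\frac{\alpha}{n}$. Suppose that $\varphi$ is a Young function whose complementary function satisfies $\overline{\varphi}\in B_p$, and that $w\in\mathcal{A}_{A,p,q,\varphi}$. Then $M_{\alpha,A^{-1}}$ is bounded from $L^p(w^p)$ into $L^q(w^q)$, i.e. there is a constant $C$ such that $\left(\int_{\mathbb{R}^n}(M_{\alpha,A^{-1}}f)^q\,w^q\,dx\right)^{1/q}\le C\left(\int_{\mathbb{R}^n}|f|^p\,w^p\,dx\right)^{1/p}$ for all $f\in L^p(w^p)$.
   Context: A weight is a locally integrable function $w$ on $\mathbb{R}^n$ with $0<w<\infty$ a.e. Cubes $Q$ have sides parallel to the axes. For an invertible matrix $A$, $w_A(x)=w(Ax)$ and $M_{\alpha,A^{-1}}f(x)=M_\alpha f(A^{-1}x)=\sup_{Q\ni A^{-1}x}\frac1{|Q|^{1-\alpha/n}}\int_Q|f(y)|\,dy$. A Young function is a function $\Psi:[0,\infty)\to[0,\infty)$ that is continuous, convex, non-decreasing, with $\Psi(0)=0$ and $\lim_{t\to\infty}\Psi(t)=\infty$. Its complementary function is $\overline{\Psi}(t)=\sup_{s\ge 0}(st-\Psi(s))$. The Luxemburg average on a cube is $\|f\|_{\Psi,Q}=\inf\{\lambda>0:\frac1{|Q|}\int_Q\Psi(|f|/\lambda)\le 1\}$, and for $1\le r<\infty$, $\|f\|_{r,Q}=\left(\frac1{|Q|}\int_Q|f|^r\right)^{1/r}$.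 A Young function $\Psi$ belongs to $B_p$ if $\int_1^\infty\frac{\Psi(t)}{t^p}\frac{dt}{t}<\infty$. For $1<p,q<\infty$, a weight $w$ belongs to $\mathcal{A}_{A,p,q,\varphi}$ if $[w]_{\mathcal{A}_{A,p,q,\varphi}}=\sup_Q\|w_A^{1/q}\|_{q,Q}\,\|w^{-1/p}\|_{\varphi,Q}<\infty$, the supremum being over all cubes $Q$.
   Formalization: The class is taken with ‖w_A‖_{q,Q}‖w^{-1}‖_{φ,Q} in place of the printed ‖w_A^{1/q}‖_{q,Q}‖w^{-1/p}‖_{φ,Q}; as printed the claim fails, e.g. n=1, A=1, α=1/4, p=2, q=4, φ(t)=t³, w=max(1,|x|^{-1/2}). *)

theory Defs
  imports "HOL-Analysis.Analysis"
begin

text \<open>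
  Norms, averages and maximal functions take values in \<open>ennreal\<close>, so that no integral or
  supremum is silently set to 0 when it is infinite.
\<close>

definition epowr :: "ennreal \<Rightarrow> real \<Rightarrow> ennreal" where
  \<comment> \<open>only meant for positive exponents: infinity is sent to infinity\<close>
  "epowr x r = (if x = \<infinity> then \<infinity> else ennreal (enn2real x powr r))"

definition cubes :: "(real ^ 'n) set set" where
  "cubes = {cbox a (a + vec l) | a l. 0 < l}"

definition weight :: "(real ^ 'n \<Rightarrow> real) \<Rightarrow> bool" where
  "weight w \<longleftrightarrow> (\<forall>K. compact K \<longrightarrow> w absolutely_integrable_on K) \<and> (AE x in lebesgue. 0 < w x)"

definition cube_avg :: "(real ^ 'n \<Rightarrow> real) \<Rightarrow> (real ^ 'n) set \<Rightarrow> ennreal" where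
  \<comment> \<open>for nonnegative functions only, negative values being truncated to 0\<close>
  "cube_avg g Q = (\<integral>\<^sup>+ x \<in> Q. ennreal (g x) \<partial>lebesgue) / emeasure lebesgue Q"

definition Lr_avg :: "real \<Rightarrow> (real ^ 'n \<Rightarrow> real) \<Rightarrow> (real ^ 'n) set \<Rightarrow> ennreal" where
  "Lr_avg r f Q = epowr (cube_avg (\<lambda>x. \<bar>f x\<bar> powr r) Q) (1 / r)"

definition young :: "(real \<Rightarrow> real) \<Rightarrow> bool" where
  \<comment> \<open>values at negative arguments are irrelevant; nonnegativity follows from monotonicity\<close>
  "young \<Psi> \<longleftrightarrow> continuous_on {0..} \<Psi> \<and> convex_on {0..} \<Psi> \<and> mono_on {0..} \<Psi> \<and>
     \<Psi> 0 = 0 \<and> filterlim \<Psi> at_top at_top"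

definition complementary :: "(real \<Rightarrow> real) \<Rightarrow> real \<Rightarrow> ennreal" where
  \<comment> \<open>truncating at 0 is harmless since the term for \<open>s = 0\<close> vanishes; the value may be infinite\<close>
  "complementary \<Psi> t = (SUP s \<in> {0..}. ennreal (s * t - \<Psi> s))"

definition Luxemburg_avg :: "(real \<Rightarrow> real) \<Rightarrow> (real ^ 'n \<Rightarrow> real) \<Rightarrow> (real ^ 'n) set \<Rightarrow> ennreal" where
  \<comment> \<open>infinite if there is no admissible \<open>c\<close>\<close>
  "Luxemburg_avg \<Psi> f Q =
     Inf {ennreal c | c. 0 < c \<and> cube_avg (\<lambda>x. \<Psi> (\<bar>f x\<bar> / c)) Q \<le> 1}"

definition B_class :: "real \<Rightarrow> (real \<Rightarrow> ennreal) set" where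
  "B_class p = {\<Psi>. (\<integral>\<^sup>+ t \<in> {1..}. \<Psi> t * ennreal (1 / t powr p) * ennreal (1 / t) \<partial>lborel) < \<infinity>}"

definition frac_maximal :: "real \<Rightarrow> (real ^ 'n \<Rightarrow> real) \<Rightarrow> real ^ 'n \<Rightarrow> ennreal" where
  "frac_maximal \<alpha> f x = (SUP Q \<in> {Q \<in> cubes. x \<in> Q}.
     (\<integral>\<^sup>+ y \<in> Q. ennreal \<bar>f y\<bar> \<partial>lebesgue) / ennreal (measure lebesgue Q powr (1 - \<alpha> / CARD('n))))"

definition frac_maximal_mat ::
    "real \<Rightarrow> real ^ 'n ^ 'n \<Rightarrow> (real ^ 'n \<Rightarrow> real) \<Rightarrow> real ^ 'n \<Rightarrow> ennreal" where
  "frac_maximal_mat \<alpha> B f x = frac_maximal \<alpha> f (B *v x)"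

text \<open>
  The class is normalised for the weights \<open>w powr p\<close> and \<open>w powr q\<close>, as is the classical
  Muckenhoupt-Wheeden class \<open>A(p,q)\<close>: the two factors are the \<open>L\<^sup>q\<close> average of \<open>w\<^sub>A\<close> and the
  Luxemburg average of \<open>1 / w\<close>. The source prints \<open>w\<^sub>A powr (1/q)\<close> and \<open>w powr (-1/p)\<close> instead,
  which is the normalisation for \<open>L\<^sup>p(w)\<close> and \<open>L\<^sup>q(w)\<close>. With that formula boundedness from
  \<open>L\<^sup>p(w powr p)\<close> into \<open>L\<^sup>q(w powr q)\<close> fails, for instance for \<open>n = 1\<close>, \<open>A = 1\<close>, \<open>\<alpha> = 1/4\<close>,
  \<open>p = 2\<close>, \<open>q = 4\<close>, \<open>\<phi> t = t powr 3\<close> and \<open>w x = max 1 (\<bar>x\<bar> powr (-1/2))\<close>: the supremum is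
  finite, but \<open>w powr 4\<close> is not integrable near 0. In the present normalisation the exponent
  \<open>p\<close> no longer enters the formula.
\<close>

definition bump_const ::
    "real ^ 'n ^ 'n \<Rightarrow> real \<Rightarrow> (real \<Rightarrow> real) \<Rightarrow> (real ^ 'n \<Rightarrow> real) \<Rightarrow> ennreal" where
  "bump_const A q \<phi> w =
     (SUP Q \<in> cubes. Lr_avg q (\<lambda>x. w (A *v x)) Q * Luxemburg_avg \<phi> (\<lambda>x. 1 / w x) Q)"

definition bump_class ::
    "real ^ 'n ^ 'n \<Rightarrow> real \<Rightarrow> (real \<Rightarrow> real) \<Rightarrow> (real ^ 'n \<Rightarrow> real) set" where
  "bump_class A q \<phi> = {w. weight w \<and> bump_const A q \<phi> w < \<infinity>}"

definition weighted_norm :: "real \<Rightarrow> (real ^ 'n \<Rightarrow> real) \<Rightarrow> (real ^ 'n \<Rightarrow> ennreal) \<Rightarrow> ennreal" where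
  "weighted_norm r v g = epowr (\<integral>\<^sup>+ x. epowr (g x) r * ennreal (v x) \<partial>lebesgue) (1 / r)"

definition weighted_Lp :: "real \<Rightarrow> (real ^ 'n \<Rightarrow> real) \<Rightarrow> (real ^ 'n \<Rightarrow> real) set" where
  "weighted_Lp r v = {f \<in> borel_measurable lebesgue. weighted_norm r v (\<lambda>x. ennreal \<bar>f x\<bar>) < \<infinity>}"

end

theory Submission
  imports Defs
begin

text \<open>
  After the change of variables \<open>y = A\<^sup>-\<^sup>1 x\<close> this is a two-weight inequality for the fractional
  maximal operator with the weights \<open>u(y) = w(A y)\<close> and \<open>w\<close>, and Perez' argument applies. The
  operator is dominated by its dyadic version, where a cube \<open>Q\<close> acts on its triple \<open>3Q\<close>. At each
  level \<open>a\<^sup>k\<close> take the maximal dyadic cubes whose fractional average exceeds \<open>a\<^sup>k\<close>. On each of them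
  Hoelder's inequality for \<open>\<phi>\<close> and its complementary function, together with the bump condition
  on \<open>3Q\<close>, bounds \<open>a\<^sup>k\<^sup>q u\<^sup>q(3Q)\<close> by a multiple of \<open>(|Q| n\<^sub>Q\<^sup>p)\<^sup>q\<^sup>/\<^sup>p\<close>, where \<open>n\<^sub>Q\<close> is the Luxemburg
  average of \<open>f w\<close> over \<open>Q\<close>. For \<open>a\<close> large the selected cubes have pairwise disjoint parts
  of at least half their measure. As \<open>q \<ge> p\<close>, the sum over all of them is therefore controlled by
  the \<open>L\<^sup>p\<close> norm of the dyadic maximal function built from the \<open>n\<^sub>Q\<close>, and that maximal function
  is bounded on \<open>L\<^sup>p\<close> by the \<open>B\<^sub>p\<close> condition.
\<close>

section \<open>Powers in the extended nonnegative reals\<close>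

text \<open>Triples appear because a cube need not lie in a dyadic cube of comparable size, while
  the selection of maximal cubes needs nested ones. So \<open>f\<close> is integrated over the
  dyadic cube and the weight over its triple; the triple belongs to \<open>cubes\<close>, so the
  bump condition applies to it directly and the weight need not be doubling. The main obstacle is
  that maximal cubes at a level exist only if large cubes have small fractional averages. This holds
  for integrable \<open>f\<close>, since |Q|^(\<alpha>/n - 1) decays; other \<open>f\<close> are
  reached by truncation and monotone convergence, with a constant independent of the truncation. The
  base a = 2^(n+1) comes from the parent cube: comparing with it costs 2^(n-\<alpha>), and the
  remaining factor leaves at least half of the cube free. The relation between p and q gives p <= q,
  and it also makes the scales match: |Q|^(\<alpha> q/n) |Q| = |Q|^(q/p). The B_p condition is used
  twice: as a finite dyadic sum, and to know that the complementary function, which may take the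
  value infinity, is finite somewhere and hence small near 0.\<close>

lemma epowr_ennreal: "0 \<le> x \<Longrightarrow> epowr (ennreal x) r = ennreal (x powr r)"
  by (simp add: epowr_def)

lemma epowr_top [simp]: "epowr top r = top"
  by (simp add: epowr_def)

lemma epowr_0 [simp]: "epowr 0 r = 0"
  by (simp add: epowr_def)

lemma epowr_mono: "0 \<le> r \<Longrightarrow> x \<le> y \<Longrightarrow> epowr x r \<le> epowr y r"
  by (cases x rule: ennreal_cases; cases y rule: ennreal_cases)
     (auto simp: epowr_ennreal top_unique powr_mono2 intro!: ennreal_leI)

lemma epowr_mult:
  assumes "0 < r"
  shows "epowr (x * y) r = epowr x r * epowr y r"
proof (cases "x = 0 \<or> y = 0")
  case False
  show ?thesis
    using False assms
    by (cases x rule: ennreal_cases; cases y rule: ennreal_cases)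
       (auto simp: epowr_ennreal ennreal_mult[symmetric] powr_mult
          ennreal_mult_top ennreal_top_mult)
qed auto

lemma epowr_epowr: "epowr (epowr x r) s = epowr x (r * s)"
  by (cases x rule: ennreal_cases) (auto simp: epowr_ennreal powr_powr)

lemma epowr_1 [simp]: "epowr x 1 = x"
  by (cases x rule: ennreal_cases) (auto simp: epowr_ennreal)

lemma epowr_inverse [simp]:
  assumes "r \<noteq> 0"
  shows "epowr (epowr x r) (1 / r) = x" "epowr (epowr x (1 / r)) r = x"
  using assms by (simp_all add: epowr_epowr)

lemma epowr_le_iff:
  assumes "0 < r"
  shows "epowr x r \<le> y \<longleftrightarrow> x \<le> epowr y (1 / r)"
  using epowr_mono[of r x "epowr y (1 / r)"] epowr_mono[of "1 / r" "epowr x r" y] assms by auto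

text \<open>By \<open>epowr_le_iff\<close> a positive power has the inverse power as adjoint, so it
  preserves suprema; continuity is not involved.\<close>

lemma epowr_SUP:
  assumes "0 < r"
  shows "epowr (SUP i\<in>I. h i) r = (SUP i\<in>I. epowr (h i) r)"
proof (rule antisym)
  show "epowr (SUP i\<in>I. h i) r \<le> (SUP i\<in>I. epowr (h i) r)"
    unfolding epowr_le_iff[OF assms]
  proof (rule SUP_least)
    fix i assume "i \<in> I"
    then have "epowr (h i) r \<le> (SUP i\<in>I. epowr (h i) r)" by (rule SUP_upper)
    then show "h i \<le> epowr (SUP i\<in>I. epowr (h i) r) (1 / r)"
      by (simp only: epowr_le_iff[OF assms])
  qed
  show "(SUP i\<in>I. epowr (h i) r) \<le> epowr (SUP i\<in>I. h i) r"
    using assms by (intro SUP_least epowr_mono SUP_upper) auto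
qed

lemma measurable_epowr [measurable]:
  assumes [measurable]: "f \<in> borel_measurable M"
  shows "(\<lambda>x. epowr (f x) r) \<in> borel_measurable M"
  unfolding epowr_def by measurable

text \<open>This is the embedding of l^1 into l^r. Each term is at most the total S, so its r-th
  power is at most the term times S^(r-1); summing gives S^r.\<close>

lemma epowr_sum_le:
  assumes "1 \<le> r"
  shows "(\<integral>\<^sup>+i. epowr (x i) r \<partial>count_space I) \<le> epowr (\<integral>\<^sup>+i. x i \<partial>count_space I) r"
proof -
  define S where "S = (\<integral>\<^sup>+i. x i \<partial>count_space I)"
  show ?thesis
  proof (cases "S = top")
    case False
    have pt: "epowr (x i) r \<le> x i * epowr S (r - 1)" if "i \<in> I" for i
    proof -
      have le: "x i \<le> S"
        unfolding S_def using that by (rule nn_integral_ge_point)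
      obtain s where s: "S = ennreal s" "0 \<le> s"
        using False by (cases S rule: ennreal_cases) auto
      obtain t where t: "x i = ennreal t" "0 \<le> t"
        using le False by (cases "x i" rule: ennreal_cases) (auto simp: top_unique)
      have ts: "t \<le> s" using le s t by simp
      have "t powr r = t * t powr (r - 1)"
        using t(2) powr_add[of t 1 "r - 1"] by (cases "t = 0") auto
      also have "\<dots> \<le> t * s powr (r - 1)"
        using ts t assms by (intro mult_left_mono powr_mono2) auto
      finally show ?thesis
        using s t by (simp add: epowr_ennreal ennreal_mult[symmetric] ennreal_leI)
    qed
    have "(\<integral>\<^sup>+i. epowr (x i) r \<partial>count_space I) \<le> (\<integral>\<^sup>+i. x i * epowr S (r - 1) \<partial>count_space I)"
      using pt by (intro nn_integral_mono) auto
    also have "\<dots> = S * epowr S (r - 1)"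
      unfolding S_def by (rule nn_integral_multc) auto
    also have "\<dots> = epowr S r"
    proof -
      obtain s where s: "S = ennreal s" "0 \<le> s"
        using False by (cases S rule: ennreal_cases) auto
      have "s powr r = s * s powr (r - 1)"
        using s(2) powr_add[of s 1 "r - 1"] by (cases "s = 0") auto
      then show ?thesis using s by (simp add: epowr_ennreal ennreal_mult[symmetric])
    qed
    finally show ?thesis by (simp add: S_def)
  qed (simp add: S_def[symmetric])
qed

lemma ex_int_powr_level:
  fixes b x :: real
  assumes "1 < b" "0 < x"
  obtains k :: int where "b powr k < x" "x \<le> b powr (k + 1)"
proof -
  \<comment> \<open>Ceiling minus one rather than floor: the lower inequality has to be strict,
    because the level sets are defined by strict inequalities.\<close>
  define k where "k = \<lceil>log b x\<rceil> - 1"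
  have "real_of_int k < log b x" "log b x \<le> k + 1"
    unfolding k_def by linarith+
  then show ?thesis
    using assms that[of k] by (simp add: less_log_iff log_le_iff)
qed

text \<open>A function that takes the value infinity is covered too: then all levels contribute.\<close>

lemma epowr_le_layers:
  fixes b r :: real
  assumes "1 < b" "0 < r"
  shows "epowr h r \<le>
    (\<integral>\<^sup>+k. ennreal (b powr ((of_int k + 1) * r)) * of_bool (ennreal (b powr of_int k) < h)
      \<partial>count_space (UNIV :: int set))" (is "_ \<le> (\<integral>\<^sup>+k. ?g k \<partial>_)")
proof (cases h rule: ennreal_cases)
  case (real x)
  show ?thesis
  proof (cases "x = 0")
    case False
    then have "0 < x" using real by simp
    then obtain k :: int where k: "b powr k < x" "x \<le> b powr (k + 1)"
      using ex_int_powr_level[OF assms(1)] by metis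
    \<comment> \<open>For finite positive \<open>h\<close> the highest level below it already
      dominates, since its weight is the r-th power of the next level.\<close>
    have "epowr h r \<le> ?g k"
      using real k assms powr_mono2[of r x "b powr (k+1)"]
      by (auto simp: epowr_ennreal powr_powr ennreal_less_iff intro!: ennreal_leI)
    also have "\<dots> \<le> (\<integral>\<^sup>+k. ?g k \<partial>count_space UNIV)"
      by (rule nn_integral_ge_point) simp
    finally show ?thesis .
  qed (use real in simp)
next
  case top
  have "ennreal (real n) \<le> (\<integral>\<^sup>+k. ?g k \<partial>count_space UNIV)" for n
  proof -
    have "real n = (\<Sum>k\<in>{0..<int n}. 1)" by simp
    also have "\<dots> \<le> (\<Sum>k\<in>{0..<int n}. b powr ((of_int k + 1) * r))"
      using assms by (intro sum_mono) (auto intro!: ge_one_powr_ge_zero)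
    finally have "ennreal (real n) \<le> ennreal (\<Sum>k\<in>{0..<int n}. b powr ((of_int k + 1) * r))"
      by (rule ennreal_leI)
    also have "\<dots> = (\<Sum>k\<in>{0..<int n}. ?g k)"
      by (subst sum_ennreal[symmetric]) (auto simp: top)
    also have "\<dots> = (\<integral>\<^sup>+k. ?g k \<partial>count_space {0..<int n})"
      by (rule nn_integral_count_space_finite[symmetric]) simp
    also have "\<dots> = (\<integral>\<^sup>+k. ?g k * indicator {0..<int n} k \<partial>count_space UNIV)"
      by (rule nn_integral_count_space_indicator) simp
    also have "\<dots> \<le> (\<integral>\<^sup>+k. ?g k \<partial>count_space UNIV)"
      by (intro nn_integral_mono) (auto simp: indicator_def)
    finally show ?thesis .
  qed
  then have "of_nat n \<le> (\<integral>\<^sup>+k. ?g k \<partial>count_space UNIV)" for n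
    by (simp only: ennreal_of_nat_eq_real_of_nat)
  then have "\<not> (\<integral>\<^sup>+k. ?g k \<partial>count_space UNIV) < top"
    using ennreal_Ex_less_of_nat[of "\<integral>\<^sup>+k. ?g k \<partial>count_space UNIV"] by (meson not_le)
  then have "(\<integral>\<^sup>+k. ?g k \<partial>count_space UNIV) = top"
    using less_top by blast
  then show ?thesis by simp
qed

section \<open>Dyadic cubes\<close>

definition dside :: "int \<Rightarrow> real" where
  "dside k = 2 powr of_int k"

definition dindex :: "int \<Rightarrow> real ^ 'n \<Rightarrow> int ^ 'n" where
  "dindex k x = (\<chi> i. \<lfloor>x $ i / dside k\<rfloor>)"

text \<open>Cubes are handled through pairs of scale and corner index, so families of them are
  automatically countable. They are half-open, so those of one scale partition the space.\<close>

definition dcube :: "int \<times> (int ^ 'n) \<Rightarrow> (real ^ 'n) set" where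
  "dcube Q = {x. dindex (fst Q) x = snd Q}"

text \<open>Closed, unlike \<open>dcube\<close>, so that it is a member of \<open>cubes\<close> and
  the bump condition can be tested on it.\<close>

definition dcube3 :: "int \<times> (int ^ 'n) \<Rightarrow> (real ^ 'n) set" where
  "dcube3 Q = (let a = (\<chi> i. dside (fst Q) * (of_int (snd Q $ i) - 1))
     in cbox a (a + vec (3 * dside (fst Q))))"

lemma dside_pos [simp]: "0 < dside k"
  by (simp add: dside_def)

lemma dside_nonneg [simp]: "0 \<le> dside k"
  by (simp add: dside_def)

lemma dside_nz [simp]: "dside k \<noteq> 0"
  by (simp add: dside_def)

lemma dside_mono: "k \<le> l \<Longrightarrow> dside k \<le> dside l"
  by (simp add: dside_def)

lemma dside_Suc: "dside (k + 1) = 2 * dside k"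
  by (simp add: dside_def powr_add)

lemma dside_split: "k \<le> l \<Longrightarrow> dside l = dside k * of_int (2 ^ nat (l - k))"
  unfolding dside_def
  by (simp add: powr_realpow[symmetric] powr_add[symmetric])

lemma mem_dcube:
  "x \<in> dcube (k, m) \<longleftrightarrow> (\<forall>i. dside k * of_int (m $ i) \<le> x $ i \<and> x $ i < dside k * (of_int (m $ i) + 1))"
  by (simp add: dcube_def dindex_def vec_eq_iff floor_eq_iff field_simps)

lemma dcube_dindex [simp]: "x \<in> dcube (k, dindex k x)"
  by (simp add: dcube_def)

lemma mem_dcube3:
  "x \<in> dcube3 (k, m) \<longleftrightarrow>
    (\<forall>i. dside k * (of_int (m $ i) - 1) \<le> x $ i \<and> x $ i \<le> dside k * (of_int (m $ i) + 2))"
  by (simp add: dcube3_def Let_def mem_box_cart algebra_simps)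

lemma dcube3_cubes: "dcube3 Q \<in> cubes"
  unfolding dcube3_def Let_def cubes_def using dside_pos[of "fst Q"] by fastforce

lemma dcube_subset_dcube3: "dcube Q \<subseteq> dcube3 Q"
proof
  fix x assume "x \<in> dcube Q"
  then show "x \<in> dcube3 Q"
    using dside_pos[of "fst Q"]
    by (cases Q) (auto simp: mem_dcube mem_dcube3 algebra_simps, smt+)
qed

text \<open>The index at a coarse scale is a function of the index at any finer one. This is the
  source of the nesting of dyadic cubes.\<close>

lemma dindex_coarser:
  assumes "k \<le> l"
  shows "dindex l x $ i = (dindex k x $ i) div 2 ^ nat (l - k)"
proof -
  have "\<lfloor>x $ i / dside l\<rfloor> = \<lfloor>(x $ i / dside k) / of_int (2 ^ nat (l - k))\<rfloor>"
    by (simp add: dside_split[OF assms])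
  also have "\<dots> = \<lfloor>x $ i / dside k\<rfloor> div 2 ^ nat (l - k)"
    by (rule floor_divide_real_eq_div) simp
  finally show ?thesis by (simp add: dindex_def)
qed

lemma dcube_subset:
  assumes "fst P \<le> fst Q" "x \<in> dcube P" "x \<in> dcube Q"
  shows "dcube P \<subseteq> dcube Q"
proof
  fix y assume "y \<in> dcube P"
  then have "dindex (fst P) y = dindex (fst P) x"
    using assms(2) by (simp add: dcube_def)
  then have "dindex (fst Q) y = dindex (fst Q) x"
    by (simp add: vec_eq_iff dindex_coarser[OF assms(1)])
  then show "y \<in> dcube Q"
    using assms(3) by (simp add: dcube_def)
qed

lemma dcube_disjoint: "P \<noteq> Q \<Longrightarrow> fst P = fst Q \<Longrightarrow> dcube P \<inter> dcube Q = {}"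
  by (auto simp: dcube_def prod_eq_iff)

lemma dcube_nonempty: "dcube Q \<noteq> {}"
proof -
  have "(\<chi> i. dside (fst Q) * of_int (snd Q $ i)) \<in> dcube Q"
    by (cases Q) (simp add: mem_dcube)
  then show ?thesis by blast
qed

lemma dcube3_mono:
  assumes "fst P \<le> fst Q" "dcube P \<subseteq> dcube Q"
  shows "dcube3 P \<subseteq> dcube3 Q"
proof -
  obtain k m where P: "P = (k, m)" by (cases P)
  obtain l n where Q: "Q = (l, n)" by (cases Q)
  have kl: "k \<le> l" using assms P Q by simp
  have "(\<chi> i. dside k * of_int (m $ i)) \<in> dcube Q"
    using assms(2) by (auto simp: P mem_dcube)
  then have low: "dside l * of_int (n $ i) \<le> dside k * of_int (m $ i)" for i
    by (simp add: Q mem_dcube)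
  \<comment> \<open>The upper corner of P is not a point of P, so the inclusion cannot be evaluated
    there. Integrality replaces it: m < N (n + 1) for integers gives m + 1 <= N (n + 1).\<close>
  have up: "dside k * (of_int (m $ i) + 1) \<le> dside l * (of_int (n $ i) + 1)" for i
  proof -
    define N :: int where "N = 2 ^ nat (l - k)"
    have "0 < N" by (simp add: N_def)
    have dl: "dside l = dside k * of_int N"
      unfolding N_def by (rule dside_split[OF kl])
    have "dside k * of_int (m $ i) < dside l * (of_int (n $ i) + 1)"
      using \<open>(\<chi> i. dside k * of_int (m $ i)) \<in> dcube Q\<close> by (simp add: Q mem_dcube)
    then have "real_of_int (m $ i) < of_int (N * (n $ i + 1))"
      by (simp add: dl mult.assoc)
    then have "m $ i + 1 \<le> N * (n $ i + 1)" by linarith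
    then have "real_of_int (m $ i + 1) \<le> of_int (N * (n $ i + 1))" by linarith
    then show ?thesis by (simp add: dl mult.assoc)
  qed
  have "dside k \<le> dside l" by (rule dside_mono[OF kl])
  then show ?thesis
    using low up
    by (auto simp: P Q mem_dcube3 algebra_simps) (smt (verit))+
qed

lemma dcube_borel [measurable]: "dcube Q \<in> sets borel"
proof -
  have "dcube Q = {x. \<forall>i. dside (fst Q) * of_int (snd Q $ i) \<le> x $ i \<and> x $ i < dside (fst Q) * (of_int (snd Q $ i) + 1)}"
    by (cases Q) (auto simp: mem_dcube)
  also have "\<dots> \<in> sets borel"
    by measurable
  finally show ?thesis .
qed

lemma dcube_lebesgue [measurable, simp]: "dcube Q \<in> sets lebesgue"
  using dcube_borel[of Q] by (simp add: sets_completionI_sets)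

lemma dcube3_lebesgue [measurable, simp]: "dcube3 Q \<in> sets lebesgue"
  by (simp add: dcube3_def Let_def)

lemma emeasure_cbox_vec:
  fixes a :: "real ^ 'n"
  assumes "0 \<le> l"
  shows "emeasure lborel (cbox a (a + vec l)) = ennreal (l ^ CARD('n))"
proof -
  have "a \<in> cbox a (a + vec l)"
    using assms by (simp add: mem_box_cart)
  then have "measure lborel (cbox a (a + vec l)) = l ^ CARD('n)"
    using assms by (subst content_cbox_cart) auto
  moreover have "emeasure lborel (cbox a (a + vec l)) = ennreal (measure lborel (cbox a (a + vec l)))"
    by (intro emeasure_eq_ennreal_measure) (simp add: emeasure_lborel_cbox_eq)
  ultimately show ?thesis by simp
qed

lemma emeasure_dcube3:
  fixes Q :: "int \<times> (int ^ 'n)"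
  shows "emeasure lebesgue (dcube3 Q) = ennreal (3 ^ CARD('n) * dside (fst Q) ^ CARD('n))"
  by (simp add: dcube3_def Let_def emeasure_cbox_vec power_mult_distrib)

lemma emeasure_dcube:
  fixes Q :: "int \<times> (int ^ 'n)"
  shows "emeasure lebesgue (dcube Q) = ennreal (dside (fst Q) ^ CARD('n))"
proof -
  define a :: "real ^ 'n" where "a = (\<chi> i. dside (fst Q) * of_int (snd Q $ i))"
  define b where "b = a + vec (dside (fst Q))"
  have 1: "box a b \<subseteq> dcube Q" "dcube Q \<subseteq> cbox a b"
    by (cases Q; auto simp: mem_dcube mem_box_cart a_def b_def algebra_simps less_imp_le)+
  have "emeasure lebesgue (box a b) = emeasure lebesgue (cbox a b)"
    by (simp add: emeasure_lborel_box_eq emeasure_lborel_cbox_eq)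
  then have "emeasure lebesgue (dcube Q) = emeasure lebesgue (cbox a b)"
    using emeasure_mono[OF 1(1), of lebesgue] emeasure_mono[OF 1(2), of lebesgue] by auto
  then show ?thesis by (simp add: b_def emeasure_cbox_vec)
qed

section \<open>Maximal cubes of a family and disjoint coverings\<close>

text \<open>Fix a point x of P. Between the scale of P and the bound B only finitely many scales
  occur among the cubes of F that contain x; Q has the largest. A larger cube of F meeting Q would
  contain Q, hence x, and would have been preferred.\<close>

lemma maximal_dcube:
  fixes F :: "(int \<times> (int ^ 'n)) set"
  assumes bd: "\<And>Q. Q \<in> F \<Longrightarrow> fst Q \<le> B" and "P \<in> F"
  obtains Q where "Q \<in> F" "fst P \<le> fst Q" "dcube P \<subseteq> dcube Q"
    "\<And>R. R \<in> F \<Longrightarrow> dcube Q \<inter> dcube R \<noteq> {} \<Longrightarrow> fst R \<le> fst Q"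
proof -
  obtain x where x: "x \<in> dcube P" using dcube_nonempty by blast
  define S where "S = fst ` {R \<in> F. x \<in> dcube R} \<inter> {fst P..B}"
  have S: "finite S" "fst P \<in> S"
    unfolding S_def using assms(2) bd[OF assms(2)] x by auto
  then have "Max S \<in> S" by (intro Max_in) auto
  then obtain Q where Q: "Q \<in> F" "x \<in> dcube Q" "fst Q = Max S" "fst P \<le> fst Q"
    unfolding S_def by auto
  show ?thesis
  proof (rule that[OF Q(1,4)])
    show "dcube P \<subseteq> dcube Q" by (rule dcube_subset[OF Q(4) x Q(2)])
    fix R assume R: "R \<in> F" "dcube Q \<inter> dcube R \<noteq> {}"
    show "fst R \<le> fst Q"
    proof (rule ccontr)
      assume "\<not> fst R \<le> fst Q"
      then have less: "fst Q < fst R" by simp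
      obtain y where "y \<in> dcube Q" "y \<in> dcube R" using R(2) by blast
      then have "dcube Q \<subseteq> dcube R" using less by (intro dcube_subset[of Q R y]) auto
      then have "R \<in> {R \<in> F. x \<in> dcube R}" using R(1) Q(2) by blast
      then have "fst R \<in> S"
        unfolding S_def using Q(4) less bd[OF R(1)] by (intro IntI imageI) auto
      then have "fst R \<le> Max S" using S(1) by (intro Max_ge)
      then show False using less Q(3) by simp
    qed
  qed
qed

text \<open>Maximality is expressed by scale instead of inclusion, which amounts to the same because
  dyadic cubes that meet are nested.\<close>

definition maximal_dcubes :: "(int \<times> (int ^ 'n)) set \<Rightarrow> (int \<times> (int ^ 'n)) set" where
  "maximal_dcubes F = {Q \<in> F. \<forall>R\<in>F. dcube Q \<inter> dcube R \<noteq> {} \<longrightarrow> fst R \<le> fst Q}"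

lemma maximal_dcubes_cover:
  assumes "\<And>Q. Q \<in> F \<Longrightarrow> fst Q \<le> B" "P \<in> F"
  obtains Q where "Q \<in> maximal_dcubes F" "fst P \<le> fst Q" "dcube P \<subseteq> dcube Q"
proof -
  obtain Q where "Q \<in> F" "fst P \<le> fst Q" "dcube P \<subseteq> dcube Q"
    "\<And>R. R \<in> F \<Longrightarrow> dcube Q \<inter> dcube R \<noteq> {} \<Longrightarrow> fst R \<le> fst Q"
    by (rule maximal_dcube[OF assms]) auto
  then show ?thesis using that[of Q] by (auto simp: maximal_dcubes_def)
qed

lemma disjoint_maximal_dcubes: "disjoint_family_on dcube (maximal_dcubes F)"
  unfolding disjoint_family_on_def
proof (intro ballI impI)
  fix P Q assume *: "P \<in> maximal_dcubes F" "Q \<in> maximal_dcubes F" "P \<noteq> Q"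
  show "dcube P \<inter> dcube Q = {}"
  proof (rule ccontr)
    assume ne: "dcube P \<inter> dcube Q \<noteq> {}"
    then have "dcube Q \<inter> dcube P \<noteq> {}" by blast
    then have "fst P = fst Q"
      using ne *(1,2) unfolding maximal_dcubes_def by (intro antisym) auto
    then show False using dcube_disjoint[OF *(3)] ne by simp
  qed
qed

lemma nn_integral_disjoint_family_le:
  fixes A :: "'i \<Rightarrow> 'a set"
  assumes [measurable]: "h \<in> borel_measurable M" "\<And>i. i \<in> I \<Longrightarrow> A i \<in> sets M"
    and disj: "disjoint_family_on A I" and count: "countable I"
  shows "(\<integral>\<^sup>+i. (\<integral>\<^sup>+x\<in>A i. h x \<partial>M) \<partial>count_space I) \<le> (\<integral>\<^sup>+x. h x \<partial>M)"
proof -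
  have "(\<integral>\<^sup>+i. (\<integral>\<^sup>+x\<in>A i. h x \<partial>M) \<partial>count_space I)
      = (\<integral>\<^sup>+x. (\<integral>\<^sup>+i. h x * indicator (A i) x \<partial>count_space I) \<partial>M)"
    by (rule nn_integral_count_space_nn_integral[symmetric]) (use count in auto)
  also have "\<dots> \<le> (\<integral>\<^sup>+x. h x \<partial>M)"
  proof (rule nn_integral_mono)
    fix x
    have "(\<integral>\<^sup>+i. h x * indicator (A i) x \<partial>count_space I)
        = h x * (\<integral>\<^sup>+i. indicator (A i) x \<partial>count_space I)"
      by (rule nn_integral_cmult) simp
    also have "(\<integral>\<^sup>+i. indicator (A i) x \<partial>count_space I) \<le> (1 :: ennreal)"
    proof (cases "\<exists>j\<in>I. x \<in> A j")
      case True
      then obtain j where P: "j \<in> I" "x \<in> A j" by blast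
      have "indicator (A i) x = (indicator {j} i :: ennreal)" if "i \<in> I" for i
        using P that disj by (auto simp: indicator_def disjoint_family_on_def)
      then have "(\<integral>\<^sup>+i. indicator (A i) x \<partial>count_space I) = (\<integral>\<^sup>+i. indicator {j} i \<partial>count_space I)"
        by (intro nn_integral_cong) auto
      also have "\<dots> = 1" using P(1) by simp
      finally show ?thesis by simp
    next
      case False
      then have "(\<integral>\<^sup>+i. indicator (A i) x \<partial>count_space I) = (\<integral>\<^sup>+i. 0 \<partial>count_space I)"
        by (intro nn_integral_cong) (auto simp: indicator_def)
      then show ?thesis by simp
    qed
    finally show "(\<integral>\<^sup>+i. h x * indicator (A i) x \<partial>count_space I) \<le> h x"
      by (metis mult.right_neutral mult_left_mono zero_le)
  qed
  finally show ?thesis .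
qed

text \<open>The dyadic covering argument. A finite integral of \<open>h\<close> bounds the size of
  the cubes in F, so every one lies in a maximal one; the maximal cubes are disjoint, and the
  hypothesis can be summed over them without overlap.\<close>

lemma emeasure_UN_dcube_le:
  fixes F :: "(int \<times> (int ^ 'n)) set"
  assumes [measurable]: "h \<in> borel_measurable lebesgue"
    and le: "\<And>Q. Q \<in> F \<Longrightarrow> emeasure lebesgue (dcube Q) \<le> (\<integral>\<^sup>+x\<in>dcube Q. h x \<partial>lebesgue)"
  shows "emeasure lebesgue (\<Union>Q\<in>F. dcube Q) \<le> (\<integral>\<^sup>+x. h x \<partial>lebesgue)"
proof (cases "(\<integral>\<^sup>+x. h x \<partial>lebesgue) = top")
  case False
  then obtain c where c: "(\<integral>\<^sup>+x. h x \<partial>lebesgue) = ennreal c" "0 \<le> c"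
    by (cases "\<integral>\<^sup>+x. h x \<partial>lebesgue" rule: ennreal_cases) auto
  \<comment> \<open>A side above 1 is at most its n-th power, which is at most c. The maximum with 1
    covers the small sides and keeps the argument of the logarithm positive.\<close>
  have bd: "fst Q \<le> \<lceil>log 2 (max 1 c)\<rceil>" if "Q \<in> F" for Q
  proof -
    have "emeasure lebesgue (dcube Q) \<le> (\<integral>\<^sup>+x. h x \<partial>lebesgue)"
      using le[OF that] by (rule order_trans) (intro nn_integral_mono, auto simp: indicator_def)
    then have *: "dside (fst Q) ^ CARD('n) \<le> c"
      using c by (simp add: emeasure_dcube)
    have "dside (fst Q) \<le> max 1 c"
    proof (rule ccontr)
      assume "\<not> dside (fst Q) \<le> max 1 c"
      then have "max 1 c < dside (fst Q)" by (rule not_le_imp_less)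
      moreover from this have "dside (fst Q) \<le> dside (fst Q) ^ CARD('n)"
        by (intro self_le_power) (auto simp: Suc_leI)
      ultimately show False using * by simp
    qed
    then have "of_int (fst Q) \<le> log 2 (max 1 c)"
      by (simp add: dside_def le_log_iff)
    then show ?thesis by linarith
  qed
  define G where "G = maximal_dcubes F"
  have GF: "G \<subseteq> F" by (auto simp: G_def maximal_dcubes_def)
  have count: "countable G" by simp
  have "(\<Union>Q\<in>F. dcube Q) = (\<Union>Q\<in>G. dcube Q)"
  proof
    show "(\<Union>Q\<in>F. dcube Q) \<subseteq> (\<Union>Q\<in>G. dcube Q)"
    proof (rule UN_least)
      fix P assume "P \<in> F"
      obtain Q where "Q \<in> G" "dcube P \<subseteq> dcube Q"
        unfolding G_def by (rule maximal_dcubes_cover[OF bd \<open>P \<in> F\<close>]) auto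
      then show "dcube P \<subseteq> (\<Union>Q\<in>G. dcube Q)" by blast
    qed
  qed (use GF in blast)
  then have "emeasure lebesgue (\<Union>Q\<in>F. dcube Q) = (\<integral>\<^sup>+Q. emeasure lebesgue (dcube Q) \<partial>count_space G)"
    using emeasure_UN_countable[OF _ count, of dcube lebesgue] disjoint_maximal_dcubes[of F]
    unfolding G_def by simp
  also have "\<dots> \<le> (\<integral>\<^sup>+Q. (\<integral>\<^sup>+x\<in>dcube Q. h x \<partial>lebesgue) \<partial>count_space G)"
    using le GF by (intro nn_integral_mono) auto
  also have "\<dots> \<le> (\<integral>\<^sup>+x. h x \<partial>lebesgue)"
    using disjoint_maximal_dcubes[of F]
    by (intro nn_integral_disjoint_family_le) (auto simp: G_def)
  finally show ?thesis .
qed simp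

section \<open>Dyadic maximal functions\<close>

text \<open>The factor is |Q|^(\<alpha>/n - 1), written through the side length of Q.\<close>

definition dfrac :: "real \<Rightarrow> (real ^ 'n \<Rightarrow> real) \<Rightarrow> int \<times> (int ^ 'n) \<Rightarrow> ennreal" where
  "dfrac \<alpha> f Q = ennreal (dside (fst Q) powr (\<alpha> - CARD('n))) * (\<integral>\<^sup>+x\<in>dcube Q. ennreal \<bar>f x\<bar> \<partial>lebesgue)"

definition dfrac_max :: "real \<Rightarrow> (real ^ 'n \<Rightarrow> real) \<Rightarrow> real ^ 'n \<Rightarrow> ennreal" where
  "dfrac_max \<alpha> f x = (SUP Q. dfrac \<alpha> f Q * indicator (dcube3 Q) x)"

lemma measurable_dfrac_max [measurable]: "dfrac_max \<alpha> f \<in> borel_measurable lebesgue"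
  unfolding dfrac_max_def by (intro borel_measurable_SUP) auto

lemma dfrac_le_max: "x \<in> dcube3 Q \<Longrightarrow> dfrac \<alpha> f Q \<le> dfrac_max \<alpha> f x"
  unfolding dfrac_max_def by (rule SUP_upper2[of Q]) auto

text \<open>A cube of side \<open>l\<close> meets at most \<open>2 ^ n\<close> dyadic cubes of side in \<open>[l, 2 l)\<close>, and it is
  contained in the triple of each of them.\<close>

lemma frac_maximal_le_dfrac_max:
  fixes f :: "real ^ 'n \<Rightarrow> real" and \<alpha> :: real
  assumes [measurable]: "f \<in> borel_measurable lebesgue" and \<alpha>: "\<alpha> < CARD('n)"
  shows "frac_maximal \<alpha> f x \<le> ennreal (2 ^ CARD('n) * 2 powr (CARD('n) - \<alpha>)) * dfrac_max \<alpha> f x"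
  unfolding frac_maximal_def
proof (rule SUP_least)
  let ?n = "real CARD('n)"
  fix R assume "R \<in> {R \<in> cubes. x \<in> R}"
  then obtain a l where R: "R = cbox a (a + vec l)" "0 < l" "x \<in> R"
    by (auto simp: cubes_def)
  obtain k' :: int where k': "2 powr k' < l" "l \<le> 2 powr (k' + 1)"
    using ex_int_powr_level[of 2 l] R(2) by auto
  \<comment> \<open>The level lemma gives 2^k' < l <= 2^(k'+1); the upper end is taken, so that l <=
    s < 2 l.\<close>
  define k where "k = k' + 1"
  define s where "s = dside k"
  have s: "l \<le> s" "s \<le> 2 * l" "0 < s"
    using k' by (auto simp: s_def k_def dside_def powr_add)
  \<comment> \<open>S is the set of coordinates in which a cube touching R is shifted by one step
    from the cube containing the corner \<open>a\<close>. One step suffices because l <= s.\<close>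
  define P :: "'n set \<Rightarrow> int \<times> (int ^ 'n)"
    where "P S = (k, \<chi> i. \<lfloor>a $ i / s\<rfloor> + of_bool (i \<in> S))" for S
  have near: "\<lfloor>y $ i / s\<rfloor> = \<lfloor>a $ i / s\<rfloor> \<or> \<lfloor>y $ i / s\<rfloor> = \<lfloor>a $ i / s\<rfloor> + 1"
    if "y \<in> R" for y i
  proof -
    have "a $ i \<le> y $ i" "y $ i \<le> a $ i + l"
      using that by (auto simp: R(1) mem_box_cart)
    then have "a $ i / s \<le> y $ i / s" "y $ i / s \<le> a $ i / s + 1"
      using s by (auto simp: field_simps)
    then show ?thesis by linarith
  qed
  have cov: "R \<subseteq> (\<Union>S. dcube (P S))"
  proof
    fix y assume y: "y \<in> R"
    have "y \<in> dcube (P {i. \<lfloor>y $ i / s\<rfloor> \<noteq> \<lfloor>a $ i / s\<rfloor>})"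
      using near[OF y] by (auto simp: dcube_def dindex_def P_def vec_eq_iff s_def[symmetric])
    then show "y \<in> (\<Union>S. dcube (P S))" by blast
  qed
  have x3: "x \<in> dcube3 (P S)" for S
    unfolding P_def mem_dcube3
  proof
    fix i
    have "of_int \<lfloor>x $ i / s\<rfloor> \<le> x $ i / s" "x $ i / s \<le> of_int \<lfloor>x $ i / s\<rfloor> + 1" by linarith+
    then have "of_int \<lfloor>x $ i / s\<rfloor> * s \<le> x $ i" "x $ i \<le> (of_int \<lfloor>x $ i / s\<rfloor> + 1) * s"
      by (simp_all only: pos_le_divide_eq[OF s(3)] pos_divide_le_eq[OF s(3)])
    then show "dside k * (of_int ((\<chi> i. \<lfloor>a $ i / s\<rfloor> + of_bool (i \<in> S)) $ i) - 1) \<le> x $ i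
      \<and> x $ i \<le> dside k * (of_int ((\<chi> i. \<lfloor>a $ i / s\<rfloor> + of_bool (i \<in> S)) $ i) + 2)"
      using near[OF R(3), of i] s(3) by (auto simp: s_def[symmetric] algebra_simps)
  qed
  have "(\<integral>\<^sup>+y\<in>R. ennreal \<bar>f y\<bar> \<partial>lebesgue)
      \<le> (\<integral>\<^sup>+y. (\<Sum>S\<in>UNIV. ennreal \<bar>f y\<bar> * indicator (dcube (P S)) y) \<partial>lebesgue)"
  proof (rule nn_integral_mono)
    fix y
    show "ennreal \<bar>f y\<bar> * indicator R y \<le> (\<Sum>S\<in>UNIV. ennreal \<bar>f y\<bar> * indicator (dcube (P S)) y)"
    proof (cases "y \<in> R")
      case True
      then obtain S where "y \<in> dcube (P S)" using cov by blast
      then have "ennreal \<bar>f y\<bar> * indicator R y = ennreal \<bar>f y\<bar> * indicator (dcube (P S)) y"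
        using True by simp
      also have "\<dots> \<le> (\<Sum>S\<in>UNIV. ennreal \<bar>f y\<bar> * indicator (dcube (P S)) y)"
        by (rule member_le_sum) auto
      finally show ?thesis .
    qed simp
  qed
  also have "\<dots> = (\<Sum>S\<in>UNIV. \<integral>\<^sup>+y\<in>dcube (P S). ennreal \<bar>f y\<bar> \<partial>lebesgue)"
    by (rule nn_integral_sum) auto
  also have "\<dots> \<le> (\<Sum>S\<in>(UNIV :: 'n set set). ennreal (s powr (?n - \<alpha>)) * dfrac_max \<alpha> f x)"
  proof (rule sum_mono)
    fix S
    have "(\<integral>\<^sup>+y\<in>dcube (P S). ennreal \<bar>f y\<bar> \<partial>lebesgue) = ennreal (s powr (?n - \<alpha>)) * dfrac \<alpha> f (P S)"
      using s(3) by (simp add: dfrac_def P_def s_def[symmetric] mult.assoc[symmetric]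
          ennreal_mult[symmetric] powr_add[symmetric])
    also have "\<dots> \<le> ennreal (s powr (?n - \<alpha>)) * dfrac_max \<alpha> f x"
      using dfrac_le_max[OF x3] by (intro mult_left_mono) auto
    finally show "(\<integral>\<^sup>+y\<in>dcube (P S). ennreal \<bar>f y\<bar> \<partial>lebesgue)
      \<le> ennreal (s powr (?n - \<alpha>)) * dfrac_max \<alpha> f x" .
  qed
  also have "\<dots> = ennreal (2 ^ CARD('n) * s powr (?n - \<alpha>)) * dfrac_max \<alpha> f x"
    by (simp add: card_UNIV_set ennreal_mult mult.assoc ennreal_power[symmetric])
  \<comment> \<open>The factor 2^(n - \<alpha>) of the claim arises here, from s <= 2 l and the
    positive exponent n - \<alpha>.\<close>
  also have "\<dots> \<le> ennreal (2 ^ CARD('n) * 2 powr (?n - \<alpha>) * l powr (?n - \<alpha>)) * dfrac_max \<alpha> f x"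
  proof -
    have "s powr (?n - \<alpha>) \<le> (2 * l) powr (?n - \<alpha>)"
      using s \<alpha> by (intro powr_mono2) auto
    also have "\<dots> = 2 powr (?n - \<alpha>) * l powr (?n - \<alpha>)"
      using R(2) by (simp add: powr_mult)
    finally show ?thesis
      by (intro mult_right_mono ennreal_leI) (auto simp: mult.assoc)
  qed
  finally have *: "(\<integral>\<^sup>+y\<in>R. ennreal \<bar>f y\<bar> \<partial>lebesgue)
    \<le> ennreal (2 ^ CARD('n) * 2 powr (?n - \<alpha>)) * dfrac_max \<alpha> f x * ennreal (l powr (?n - \<alpha>))"
    by (simp add: ennreal_mult mult_ac)
  have "measure lebesgue R = l ^ CARD('n)"
    using R(2) emeasure_cbox_vec[of l a] by (simp add: R(1) measure_def)
  then have "measure lebesgue R powr (1 - \<alpha> / ?n) = l powr (?n - \<alpha>)"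
    using R(2) by (simp add: powr_realpow[symmetric] powr_powr right_diff_distrib)
  then show "(\<integral>\<^sup>+y\<in>R. ennreal \<bar>f y\<bar> \<partial>lebesgue) / ennreal (measure lebesgue R powr (1 - \<alpha> / ?n))
    \<le> ennreal (2 ^ CARD('n) * 2 powr (?n - \<alpha>)) * dfrac_max \<alpha> f x"
    using * R(2) by (intro divide_le_posI_ennreal) (auto simp: mult_ac)
qed

section \<open>The dyadic Luxemburg maximal function\<close>

text \<open>A Luxemburg average for a function with values in \<open>ennreal\<close>, as needed for
  a complementary function. The condition on t is multiplied by the measure of the cube to avoid a
  division, and \<open>g\<close> carries no absolute value since only nonnegative functions are
  inserted.\<close>

definition dlux :: "(real \<Rightarrow> ennreal) \<Rightarrow> (real ^ 'n \<Rightarrow> real) \<Rightarrow> int \<times> (int ^ 'n) \<Rightarrow> ennreal" where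
  "dlux \<Phi> g Q = Inf {ennreal t | t. 0 < t \<and>
     (\<integral>\<^sup>+x\<in>dcube Q. \<Phi> (g x / t) \<partial>lebesgue) \<le> emeasure lebesgue (dcube Q)}"

definition dlux_max :: "(real \<Rightarrow> ennreal) \<Rightarrow> (real ^ 'n \<Rightarrow> real) \<Rightarrow> real ^ 'n \<Rightarrow> ennreal" where
  "dlux_max \<Phi> g x = (SUP Q. dlux \<Phi> g Q * indicator (dcube Q) x)"

lemma measurable_dlux_max [measurable]: "dlux_max \<Phi> g \<in> borel_measurable lebesgue"
  unfolding dlux_max_def by (intro borel_measurable_SUP) auto

lemma dlux_le_max: "x \<in> dcube Q \<Longrightarrow> dlux \<Phi> g Q \<le> dlux_max \<Phi> g x"
  unfolding dlux_max_def by (rule SUP_upper2[of Q]) auto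

text \<open>If \<open>dlux\<close> exceeds t on Q, then t is not admissible, so the average of
  \<Phi>(g/t) over Q exceeds 1. The points with g <= t c contribute at most 1/2 of it, so the points
  with g > t c carry at least half. The covering lemma sums this over all such cubes. The cutoff is
  what makes the later sum over levels finite.\<close>

lemma weak_type_dlux_max:
  fixes g :: "real ^ 'n \<Rightarrow> real"
  assumes [measurable]: "g \<in> borel_measurable lebesgue" "\<Phi> \<in> borel_measurable borel"
    and mono: "mono \<Phi>" and small: "\<Phi> c \<le> ennreal (1 / 2)" and t: "0 < t"
  shows "emeasure lebesgue {x. ennreal t < dlux_max \<Phi> g x}
    \<le> (\<integral>\<^sup>+x. 2 * \<Phi> (g x / t) * of_bool (t * c < g x) \<partial>lebesgue)"
proof -
  define F where "F = {Q :: int \<times> (int ^ 'n). ennreal t < dlux \<Phi> g Q}"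
  have "{x. ennreal t < dlux_max \<Phi> g x} = (\<Union>Q\<in>F. dcube Q)"
  proof (intro set_eqI iffI)
    fix x assume "x \<in> {x. ennreal t < dlux_max \<Phi> g x}"
    then obtain Q where "ennreal t < dlux \<Phi> g Q * indicator (dcube Q) x"
      by (auto simp: dlux_max_def less_SUP_iff)
    then have "x \<in> dcube Q" "Q \<in> F"
      by (cases "x \<in> dcube Q"; simp add: F_def)+
    then show "x \<in> (\<Union>Q\<in>F. dcube Q)" by blast
  next
    fix x assume "x \<in> (\<Union>Q\<in>F. dcube Q)"
    then obtain Q where Q: "ennreal t < dlux \<Phi> g Q" "x \<in> dcube Q"
      by (auto simp: F_def)
    then show "x \<in> {x. ennreal t < dlux_max \<Phi> g x}"
      using less_le_trans[OF Q(1) dlux_le_max[OF Q(2)]] by simp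
  qed
  also have "emeasure lebesgue (\<Union>Q\<in>F. dcube Q)
      \<le> (\<integral>\<^sup>+x. 2 * \<Phi> (g x / t) * of_bool (t * c < g x) \<partial>lebesgue)"
  proof (rule emeasure_UN_dcube_le)
    fix Q assume "Q \<in> F"
    define v where "v = dside (fst Q) ^ CARD('n)"
    have v: "emeasure lebesgue (dcube Q) = ennreal v" "0 < v"
      unfolding v_def by (rule emeasure_dcube) simp
    define J where "J = (\<integral>\<^sup>+x\<in>dcube Q. \<Phi> (g x / t) * of_bool (t * c < g x) \<partial>lebesgue)"
    have "\<not> dlux \<Phi> g Q \<le> ennreal t" using \<open>Q \<in> F\<close> by (simp add: F_def)
    then have "\<not> (\<integral>\<^sup>+x\<in>dcube Q. \<Phi> (g x / t) \<partial>lebesgue) \<le> ennreal v"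
      unfolding dlux_def v(1) using t by (auto intro: Inf_lower)
    then have "ennreal v \<le> (\<integral>\<^sup>+x\<in>dcube Q. \<Phi> (g x / t) \<partial>lebesgue)" by simp
    also have "\<dots> \<le> (\<integral>\<^sup>+x. \<Phi> (g x / t) * of_bool (t * c < g x) * indicator (dcube Q) x
        + ennreal (1 / 2) * indicator (dcube Q) x \<partial>lebesgue)"
    proof (rule nn_integral_mono)
      fix x
      have "\<Phi> (g x / t) \<le> ennreal (1 / 2)" if "\<not> t * c < g x"
      proof -
        have "g x / t \<le> c" using that t by (simp add: field_simps)
        then have "\<Phi> (g x / t) \<le> \<Phi> c" using mono by (simp add: monoD)
        then show ?thesis using small by (rule order_trans)
      qed
      then show "\<Phi> (g x / t) * indicator (dcube Q) x \<le> \<Phi> (g x / t) * of_bool (t * c < g x) * indicator (dcube Q) x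
        + ennreal (1 / 2) * indicator (dcube Q) x"
        by (auto simp: indicator_def)
    qed
    also have "\<dots> = J + ennreal (1 / 2) * ennreal v"
      unfolding J_def v(1)[symmetric]
      by (subst nn_integral_add) (auto simp: nn_integral_cmult_indicator)
    finally have *: "ennreal v \<le> J + ennreal (1 / 2) * ennreal v" .
    have "ennreal v \<le> 2 * J"
    proof (cases J rule: ennreal_cases)
      case (real j)
      have "ennreal (j + 1 / 2 * v) = ennreal j + ennreal (1 / 2 * v)"
        by (rule ennreal_plus) (use real v(2) in auto)
      also have "ennreal (1 / 2 * v) = ennreal (1 / 2) * ennreal v"
        by (rule ennreal_mult) (use v(2) in auto)
      finally have "ennreal v \<le> ennreal (j + 1 / 2 * v)"
        using * by (simp only: real)
      then have "v \<le> j + 1 / 2 * v"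
        using real v(2) by (subst (asm) ennreal_le_iff) auto
      then show ?thesis
        using real by (simp add: numeral_mult_ennreal)
    qed auto
    then show "emeasure lebesgue (dcube Q)
      \<le> (\<integral>\<^sup>+x\<in>dcube Q. 2 * \<Phi> (g x / t) * of_bool (t * c < g x) \<partial>lebesgue)"
      unfolding v(1) J_def by (subst (asm) nn_integral_cmult[symmetric]) (auto simp: mult.assoc)
  qed measurable
  finally show ?thesis .
qed

text \<open>The cutoff stops the sum at a level comparable with s. Counting downwards from there,
  the j-th level has weight comparable with s^p 2^(-jp), and \<Phi> is evaluated below 2^(j+1). What
  remains is a discrete form of the B_p integral.\<close>

lemma sum_levels_le:
  fixes \<Phi> :: "real \<Rightarrow> ennreal" and p s :: real and J :: nat
  assumes mono: "mono \<Phi>" and p: "0 < p" and s: "0 \<le> s"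
  shows "(\<integral>\<^sup>+k. ennreal (2 powr ((of_int k + 1) * p)) * (2 * \<Phi> (s / 2 powr of_int k)
      * of_bool (2 powr of_int k * 2 powr (- real J) < s)) \<partial>count_space (UNIV :: int set))
    \<le> ennreal (2 * 2 powr ((real J + 1) * p)) *
      (\<integral>\<^sup>+j. ennreal (2 powr (- (real j * p))) * \<Phi> (2 powr (real j + 1)) \<partial>count_space (UNIV :: nat set))
      * ennreal (s powr p)"
    (is "(\<integral>\<^sup>+k. ?f k \<partial>_) \<le> _ * (\<integral>\<^sup>+j. ?d j \<partial>_) * _")
proof (cases "s = 0")
  case False
  then obtain m :: int where m: "2 powr m < s" "s \<le> 2 powr (m + 1)"
    using ex_int_powr_level[of 2 s] s by auto
  \<comment> \<open>The last level that can pass the cutoff: 2^(k-J) < s <= 2^(m+1) forces k <= m +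
    J.\<close>
  define N where "N = m + int J"
  have "?f k = 0" if "k \<notin> {..N}" for k
  proof -
    have "\<not> 2 powr of_int k * 2 powr (- real J) < s"
    proof
      assume "2 powr of_int k * 2 powr (- real J) < s"
      then have "2 powr (of_int k - real J) < s"
        by (simp add: powr_add[symmetric])
      from less_le_trans[OF this m(2)] have "of_int k - real J < real_of_int m + 1"
        by (subst (asm) powr_less_cancel_iff) auto
      then have "k < m + 1 + int J" by linarith
      then show False using that by (simp add: N_def)
    qed
    then show ?thesis by simp
  qed
  then have "(\<integral>\<^sup>+k. ?f k \<partial>count_space UNIV) = (\<integral>\<^sup>+k. ?f k \<partial>count_space {..N})"
    by (intro nn_integral_count_space_eq) auto
  also have "\<dots> = (\<integral>\<^sup>+j. ?f (N - int j) \<partial>count_space UNIV)"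
  proof (rule nn_integral_bij_count_space[symmetric])
    show "bij_betw (\<lambda>j. N - int j) UNIV {..N}"
      by (rule bij_betw_byWitness[where f' = "\<lambda>k. nat (N - k)"]) auto
  qed
  also have "\<dots> \<le> (\<integral>\<^sup>+j. ennreal (2 * 2 powr ((real J + 1) * p)) * ennreal (s powr p) * ?d j \<partial>count_space UNIV)"
  proof (rule nn_integral_mono)
    fix j :: nat
    have "s / 2 powr of_int (N - int j) \<le> 2 powr (m + 1) / 2 powr of_int (N - int j)"
      using m by (intro divide_right_mono) auto
    also have "\<dots> = 2 powr (real j + 1 - real J)"
      by (simp add: N_def powr_diff[symmetric] algebra_simps)
    also have "\<dots> \<le> 2 powr (real j + 1)" by simp
    finally have "\<Phi> (s / 2 powr of_int (N - int j)) \<le> \<Phi> (2 powr (real j + 1))"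
      by (rule monoD[OF mono])
    moreover have "2 powr ((of_int (N - int j) + 1) * p)
        \<le> 2 powr ((real J + 1) * p) * s powr p * 2 powr (- (real j * p))"
    proof -
      have "2 powr ((of_int (N - int j) + 1) * p)
          = 2 powr ((real J + 1) * p) * (2 powr m) powr p * 2 powr (- (real j * p))"
        by (simp add: N_def powr_powr powr_add[symmetric] algebra_simps)
      also have "(2 powr m) powr p \<le> s powr p"
        using m p by (intro powr_mono2) auto
      finally show ?thesis by simp
    qed
    ultimately have "?f (N - int j) \<le> ennreal (2 powr ((real J + 1) * p) * s powr p * 2 powr (- (real j * p)))
        * (2 * \<Phi> (2 powr (real j + 1)) * 1)"
      by (intro mult_mono ennreal_leI) auto
    then show "?f (N - int j) \<le> ennreal (2 * 2 powr ((real J + 1) * p)) * ennreal (s powr p) * ?d j"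
      by (simp add: ennreal_mult mult_ac)
  qed
  also have "\<dots> = ennreal (2 * 2 powr ((real J + 1) * p)) * ennreal (s powr p) * (\<integral>\<^sup>+j. ?d j \<partial>count_space UNIV)"
    by (rule nn_integral_cmult) simp
  finally show ?thesis by (simp add: mult_ac)
next
  case True
  have "\<not> 2 powr of_int k * 2 powr (- real J) < s" for k
    using mult_nonneg_nonneg[OF powr_ge_zero powr_ge_zero, of 2 "of_int k" 2 "- real J"] True by linarith
  then show ?thesis by simp
qed

text \<open>Split the p-th power into dyadic levels, apply the weak type estimate at each, and
  exchange sum and integral. For every x the inner sum is then the one bounded in
  \<open>sum_levels_le\<close>, with s = g x.\<close>

lemma strong_type_dlux_max:
  fixes g :: "real ^ 'n \<Rightarrow> real" and J :: nat
  assumes [measurable]: "g \<in> borel_measurable lebesgue" "\<Phi> \<in> borel_measurable borel"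
    and g: "\<And>x. 0 \<le> g x"
    and mono: "mono \<Phi>" and small: "\<Phi> (2 powr (- real J)) \<le> ennreal (1 / 2)" and p: "0 < p"
  shows "(\<integral>\<^sup>+x. epowr (dlux_max \<Phi> g x) p \<partial>lebesgue) \<le> ennreal (2 * 2 powr ((real J + 1) * p)) *
      (\<integral>\<^sup>+j. ennreal (2 powr (- (real j * p))) * \<Phi> (2 powr (real j + 1)) \<partial>count_space (UNIV :: nat set))
      * (\<integral>\<^sup>+x. ennreal (g x powr p) \<partial>lebesgue)" (is "_ \<le> ?C * _")
proof -
  let ?a = "\<lambda>k::int. ennreal (2 powr ((of_int k + 1) * p))"
  have "(\<integral>\<^sup>+x. epowr (dlux_max \<Phi> g x) p \<partial>lebesgue)
      \<le> (\<integral>\<^sup>+x. (\<integral>\<^sup>+k. ?a k * of_bool (ennreal (2 powr of_int k) < dlux_max \<Phi> g x) \<partial>count_space UNIV) \<partial>lebesgue)"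
    using p by (intro nn_integral_mono epowr_le_layers) auto
  also have "\<dots> = (\<integral>\<^sup>+k. (\<integral>\<^sup>+x. ?a k * of_bool (ennreal (2 powr of_int k) < dlux_max \<Phi> g x) \<partial>lebesgue) \<partial>count_space UNIV)"
    by (rule nn_integral_count_space_nn_integral) auto
  also have "\<dots> = (\<integral>\<^sup>+k. ?a k * emeasure lebesgue {x. ennreal (2 powr of_int k) < dlux_max \<Phi> g x} \<partial>count_space UNIV)"
  proof (rule nn_integral_cong)
    fix k :: int
    have "{x \<in> space lebesgue. ennreal (2 powr of_int k) < dlux_max \<Phi> g x} \<in> sets lebesgue"
      by measurable
    then have meas: "{x. ennreal (2 powr of_int k) < dlux_max \<Phi> g x} \<in> sets lebesgue"
      by (simp only: space_completion space_lborel space_borel UNIV_I simp_thms)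
    have "(\<integral>\<^sup>+x. ?a k * of_bool (ennreal (2 powr of_int k) < dlux_max \<Phi> g x) \<partial>lebesgue)
        = (\<integral>\<^sup>+x. ?a k * indicator {x. ennreal (2 powr of_int k) < dlux_max \<Phi> g x} x \<partial>lebesgue)"
      by (intro nn_integral_cong) (auto simp: indicator_def)
    also have "\<dots> = ?a k * emeasure lebesgue {x. ennreal (2 powr of_int k) < dlux_max \<Phi> g x}"
      by (rule nn_integral_cmult_indicator[OF meas])
    finally show "(\<integral>\<^sup>+x. ?a k * of_bool (ennreal (2 powr of_int k) < dlux_max \<Phi> g x) \<partial>lebesgue)
        = ?a k * emeasure lebesgue {x. ennreal (2 powr of_int k) < dlux_max \<Phi> g x}" .
  qed
  also have "\<dots> \<le> (\<integral>\<^sup>+k. ?a k * (\<integral>\<^sup>+x. 2 * \<Phi> (g x / 2 powr of_int k)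
      * of_bool (2 powr of_int k * 2 powr (- real J) < g x) \<partial>lebesgue) \<partial>count_space UNIV)"
  proof (rule nn_integral_mono)
    fix k :: int
    show "?a k * emeasure lebesgue {x. ennreal (2 powr of_int k) < dlux_max \<Phi> g x}
      \<le> ?a k * (\<integral>\<^sup>+x. 2 * \<Phi> (g x / 2 powr of_int k)
        * of_bool (2 powr of_int k * 2 powr (- real J) < g x) \<partial>lebesgue)"
      by (rule mult_left_mono[OF weak_type_dlux_max[OF assms(1,2) mono small]]) simp_all
  qed
  also have "\<dots> = (\<integral>\<^sup>+k. (\<integral>\<^sup>+x. ?a k * (2 * \<Phi> (g x / 2 powr of_int k)
      * of_bool (2 powr of_int k * 2 powr (- real J) < g x)) \<partial>lebesgue) \<partial>count_space UNIV)"
  proof (rule nn_integral_cong)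
    fix k :: int
    have "(\<lambda>x. 2 * \<Phi> (g x / 2 powr of_int k) * of_bool (2 powr of_int k * 2 powr (- real J) < g x))
        \<in> borel_measurable lebesgue"
      by measurable
    then show "?a k * (\<integral>\<^sup>+x. 2 * \<Phi> (g x / 2 powr of_int k)
      * of_bool (2 powr of_int k * 2 powr (- real J) < g x) \<partial>lebesgue) =
      (\<integral>\<^sup>+x. ?a k * (2 * \<Phi> (g x / 2 powr of_int k)
      * of_bool (2 powr of_int k * 2 powr (- real J) < g x)) \<partial>lebesgue)"
      by (rule nn_integral_cmult[symmetric])
  qed
  also have "\<dots> = (\<integral>\<^sup>+x. (\<integral>\<^sup>+k. ?a k * (2 * \<Phi> (g x / 2 powr of_int k)
      * of_bool (2 powr of_int k * 2 powr (- real J) < g x)) \<partial>count_space UNIV) \<partial>lebesgue)"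
    by (rule nn_integral_count_space_nn_integral[symmetric]) auto
  also have "\<dots> \<le> (\<integral>\<^sup>+x. ?C * ennreal (g x powr p) \<partial>lebesgue)"
    using g by (intro nn_integral_mono sum_levels_le[OF mono p])
  also have "\<dots> = ?C * (\<integral>\<^sup>+x. ennreal (g x powr p) \<partial>lebesgue)"
    by (rule nn_integral_cmult) measurable
  finally show ?thesis .
qed

section \<open>Complementary functions and the class \<open>B\<^sub>p\<close>\<close>

lemma mono_complementary: "mono (complementary \<phi>)"
  unfolding complementary_def
  by (intro monoI SUP_mono) (auto intro!: bexI ennreal_leI mult_left_mono)

lemma borel_measurable_mono_ennreal:
  fixes f :: "real \<Rightarrow> ennreal"
  assumes "mono f"
  shows "f \<in> borel_measurable borel"
proof (rule borel_measurableI_greater)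
  fix y
  have "is_interval {x. y < f x}"
    unfolding is_interval_1 using assms by (auto simp: mono_def intro: less_le_trans)
  then have "{x. y < f x} \<in> sets borel"
    by (intro real_interval_borel_measurable)
  then show "{x \<in> space borel. y < f x} \<in> sets borel" by simp
qed

lemma measurable_complementary: "complementary \<phi> \<in> borel_measurable borel"
  by (rule borel_measurable_mono_ennreal[OF mono_complementary])

lemma young_nonneg: "young \<phi> \<Longrightarrow> 0 \<le> s \<Longrightarrow> 0 \<le> \<phi> s"
  unfolding young_def by (metis atLeast_iff mono_onD order_refl)

lemma young_inequality:
  assumes "young \<phi>" "0 \<le> s"
  shows "ennreal (s * t) \<le> ennreal (\<phi> s) + complementary \<phi> t"
proof -
  have "0 \<le> \<phi> s" by (rule young_nonneg[OF assms])
  have "ennreal (s * t) \<le> ennreal (\<phi> s + max 0 (s * t - \<phi> s))"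
    by (rule ennreal_leI) simp
  also have "\<dots> = ennreal (\<phi> s) + ennreal (s * t - \<phi> s)"
    using \<open>0 \<le> \<phi> s\<close> by (subst ennreal_plus) (auto simp: max_def ennreal_neg)
  also have "ennreal (s * t - \<phi> s) \<le> complementary \<phi> t"
    unfolding complementary_def using assms(2) by (intro SUP_upper) auto
  finally show ?thesis by (simp add: add_left_mono)
qed

text \<open>Convexity along the ray from 0, obtained term by term in the supremum: as \<phi> is
  nonnegative and c <= 1, subtracting c \<phi>(s) instead of \<phi>(s) only increases the
  term.\<close>

lemma complementary_scale:
  assumes "young \<phi>" "0 \<le> c" "c \<le> 1"
  shows "complementary \<phi> (c * t) \<le> ennreal c * complementary \<phi> t"
  unfolding complementary_def SUP_mult_left_ennreal
proof (rule SUP_mono)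
  fix s :: real assume s: "s \<in> {0..}"
  then have "0 \<le> \<phi> s" using young_nonneg[OF assms(1)] by simp
  then have "c * \<phi> s \<le> \<phi> s" using assms by (simp add: mult_left_le_one_le)
  then have "s * (c * t) - \<phi> s \<le> c * (s * t - \<phi> s)" by (simp add: algebra_simps)
  then have "ennreal (s * (c * t) - \<phi> s) \<le> ennreal c * ennreal (s * t - \<phi> s)"
    using assms by (simp add: ennreal_mult'[symmetric] ennreal_leI)
  then show "\<exists>m\<in>{0..}. ennreal (s * (c * t) - \<phi> s) \<le> ennreal c * ennreal (m * t - \<phi> m)"
    using s by blast
qed

text \<open>The j-th term is compared with the B_p integral over [2^(j+1), 2^(j+2)): by monotonicity
  \<Phi> is at least its value at the left end there, and the density is at least its value at the
  right end. These intervals are disjoint and lie in [1, infinity).\<close>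

lemma B_class_dyadic_sum:
  fixes \<Phi> :: "real \<Rightarrow> ennreal"
  assumes mono: "mono \<Phi>" and B: "\<Phi> \<in> B_class p" and p: "0 < p"
  shows "(\<integral>\<^sup>+j. ennreal (2 powr (- (real j * p))) * \<Phi> (2 powr (real j + 1)) \<partial>count_space (UNIV :: nat set)) < top"
proof -
  note [measurable] = borel_measurable_mono_ennreal[OF mono]
  define h where "h t = \<Phi> t * ennreal (1 / t powr p) * ennreal (1 / t) * indicator {1..} t" for t :: real
  have [measurable]: "h \<in> borel_measurable borel"
    unfolding h_def by measurable
  define I where "I j = {2 powr (real j + 1)..<2 powr (real j + 2)}" for j :: nat
  have I_meas: "I j \<in> sets lborel" for j
    by (simp add: I_def)
  have disj: "disjoint_family_on I UNIV"
    unfolding disjoint_family_on_def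
  proof (intro ballI impI)
    fix i j :: nat assume "i \<noteq> j"
    have "i = j" if "t \<in> I i" "t \<in> I j" for t
    proof -
      have "2 powr (real i + 1) < (2 :: real) powr (real j + 2)" "2 powr (real j + 1) < (2 :: real) powr (real i + 2)"
        using that unfolding I_def by (meson atLeastLessThan_iff order_le_less_trans)+
      then have "real i + 1 < real j + 2" "real j + 1 < real i + 2"
        by (simp_all only: powr_less_cancel_iff[of 2] one_less_numeral_iff semiring_norm)
      then show ?thesis by linarith
    qed
    then show "I i \<inter> I j = {}" using \<open>i \<noteq> j\<close> by blast
  qed
  have le: "ennreal (2 powr (- (real j * p))) * \<Phi> (2 powr (real j + 1))
      \<le> ennreal (2 * 2 powr (2 * p)) * (\<integral>\<^sup>+t\<in>I j. h t \<partial>lborel)" for j :: nat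
  proof -
    let ?s = "2 powr (real j + 1) :: real"
    have s: "2 powr (real j + 2) = 2 * ?s" "1 \<le> ?s"
      using powr_add[of 2 "real j + 1" 1] by (auto intro: ge_one_powr_ge_zero simp: algebra_simps)
    have "ennreal (1 / (2 * ?s) powr p * (1 / (2 * ?s))) * \<Phi> ?s * ennreal ?s
        = (\<integral>\<^sup>+t\<in>I j. ennreal (1 / (2 * ?s) powr p * (1 / (2 * ?s))) * \<Phi> ?s \<partial>lborel)"
      unfolding I_def s(1) using s(2) by (subst nn_integral_cmult_indicator) auto
    also have "\<dots> \<le> (\<integral>\<^sup>+t\<in>I j. h t \<partial>lborel)"
    proof (rule nn_integral_mono)
      fix t :: real
      show "ennreal (1 / (2 * ?s) powr p * (1 / (2 * ?s))) * \<Phi> ?s * indicator (I j) t \<le> h t * indicator (I j) t"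
      proof (cases "t \<in> I j")
        case True
        then have t: "?s \<le> t" "t \<le> 2 * ?s" by (auto simp: I_def s(1))
        have "1 / (2 * ?s) powr p * (1 / (2 * ?s)) \<le> 1 / t powr p * (1 / t)"
          using t s(2) p by (intro mult_mono divide_left_mono powr_mono2) auto
        moreover have "\<Phi> ?s \<le> \<Phi> t" by (rule monoD[OF mono t(1)])
        ultimately have "ennreal (1 / (2 * ?s) powr p * (1 / (2 * ?s))) * \<Phi> ?s
            \<le> ennreal (1 / t powr p * (1 / t)) * \<Phi> t"
          by (rule mult_mono[OF ennreal_leI]) simp_all
        also have "\<dots> = h t"
          using t s(2) by (simp add: h_def ennreal_mult'[symmetric] mult_ac)
        finally show ?thesis using True by simp
      qed simp
    qed
    finally have 1: "ennreal (1 / (2 * ?s) powr p * (1 / (2 * ?s))) * \<Phi> ?s * ennreal ?s \<le> (\<integral>\<^sup>+t\<in>I j. h t \<partial>lborel)" .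
    have "(2 * ?s) powr p = 2 powr (2 * p) * 2 powr (real j * p)"
      unfolding s(1)[symmetric] by (simp add: powr_powr powr_add[symmetric] algebra_simps)
    \<comment> \<open>The interval has length \<open>?s\<close>, which against the density 1/(2
      \<open>?s\<close>) leaves 1/2; together with the preceding power identity this explains the
      constant 2 * 2^(2p).\<close>
    then have "2 powr (- (real j * p)) = 2 * 2 powr (2 * p) * (1 / (2 * ?s) powr p * (1 / (2 * ?s)) * ?s)"
      by (simp add: powr_minus field_simps)
    then have "ennreal (2 powr (- (real j * p)))
        = ennreal (2 * 2 powr (2 * p)) * (ennreal (1 / (2 * ?s) powr p * (1 / (2 * ?s))) * ennreal ?s)"
      by (simp only: ennreal_mult[symmetric] mult_nonneg_nonneg powr_ge_zero divide_nonneg_nonneg zero_le_one zero_le_numeral)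
    then have "ennreal (2 powr (- (real j * p))) * \<Phi> ?s
        = ennreal (2 * 2 powr (2 * p)) * (ennreal (1 / (2 * ?s) powr p * (1 / (2 * ?s))) * \<Phi> ?s * ennreal ?s)"
      by (simp add: mult_ac)
    also have "\<dots> \<le> ennreal (2 * 2 powr (2 * p)) * (\<integral>\<^sup>+t\<in>I j. h t \<partial>lborel)"
      by (rule mult_left_mono[OF 1]) simp
    finally show ?thesis .
  qed
  have "(\<integral>\<^sup>+j. ennreal (2 powr (- (real j * p))) * \<Phi> (2 powr (real j + 1)) \<partial>count_space UNIV)
      \<le> (\<integral>\<^sup>+j. ennreal (2 * 2 powr (2 * p)) * (\<integral>\<^sup>+t\<in>I j. h t \<partial>lborel) \<partial>count_space UNIV)"
    by (intro nn_integral_mono le)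
  also have "\<dots> = ennreal (2 * 2 powr (2 * p)) * (\<integral>\<^sup>+j. (\<integral>\<^sup>+t\<in>I j. h t \<partial>lborel) \<partial>count_space UNIV)"
    by (rule nn_integral_cmult) simp
  also have "\<dots> \<le> ennreal (2 * 2 powr (2 * p)) * (\<integral>\<^sup>+t. h t \<partial>lborel)"
    using disj I_meas by (intro mult_left_mono nn_integral_disjoint_family_le) auto
  also have "\<dots> < top"
    using B by (simp add: B_class_def h_def ennreal_mult_less_top)
  finally show ?thesis .
qed

text \<open>Supplies the cutoff for the weak type estimate. The first term of the convergent dyadic
  sum shows that the complementary function is finite at 2, hence at 1; scaling down from 1 then
  makes it as small as desired.\<close>

lemma complementary_small:
  assumes "young \<phi>" "complementary \<phi> \<in> B_class p" "0 < p"
  obtains J :: nat where "complementary \<phi> (2 powr (- real J)) \<le> ennreal (1 / 2)"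
proof -
  have "ennreal (2 powr (- (real 0 * p))) * complementary \<phi> (2 powr (real 0 + 1))
      \<le> (\<integral>\<^sup>+j. ennreal (2 powr (- (real j * p))) * complementary \<phi> (2 powr (real j + 1)) \<partial>count_space (UNIV :: nat set))"
    by (rule nn_integral_ge_point) simp
  also have "\<dots> < top"
    by (rule B_class_dyadic_sum[OF mono_complementary assms(2,3)])
  finally have "complementary \<phi> 2 < top" by simp
  moreover have "complementary \<phi> 1 \<le> complementary \<phi> 2"
    using mono_complementary by (rule monoD) simp
  ultimately have "complementary \<phi> 1 < top" by (rule order.strict_trans1[rotated])
  then obtain c where c: "complementary \<phi> 1 = ennreal c" "0 \<le> c"
    by (cases "complementary \<phi> 1" rule: ennreal_cases) auto
  obtain J :: nat where J: "2 * c < 2 ^ J"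
    using real_arch_pow[of 2 "2 * c"] by auto
  have "complementary \<phi> (2 powr (- real J) * 1) \<le> ennreal (2 powr (- real J)) * complementary \<phi> 1"
    by (rule complementary_scale[OF assms(1)]) (auto simp: powr_minus powr_realpow inverse_le_1_iff)
  also have "\<dots> = ennreal (2 powr (- real J) * c)"
    using c by (simp add: ennreal_mult)
  also have "\<dots> \<le> ennreal (1 / 2)"
    using J by (intro ennreal_leI) (simp add: powr_minus powr_realpow field_simps)
  finally show ?thesis using that by simp
qed

section \<open>Hoelder's inequality with Luxemburg averages\<close>

lemma ennreal_divide_le_iff:
  assumes "0 < b"
  shows "a / ennreal b \<le> c \<longleftrightarrow> a \<le> c * ennreal b"
proof
  assume "a / ennreal b \<le> c"
  then have "a / ennreal b * ennreal b \<le> c * ennreal b" by (rule mult_right_mono) simp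
  then show "a \<le> c * ennreal b" using assms by (simp add: ennreal_divide_times)
next
  assume "a \<le> c * ennreal b"
  then show "a / ennreal b \<le> c" using assms by (intro divide_le_posI_ennreal) (auto simp: mult.commute)
qed

text \<open>Write |f| as the product of 1/w and |f w|, normalise the factors by c and t, and apply
  Young's inequality pointwise. Each of the two integrals is at most |3Q|: the first by
  admissibility of c on the triple, the second by admissibility of t on Q and |Q| <= |3Q|.\<close>

lemma cube_avg_dcube3_le:
  fixes f :: "real ^ 'n \<Rightarrow> real"
  assumes \<phi>: "young \<phi>" and [measurable]: "f \<in> borel_measurable lebesgue" "w \<in> borel_measurable lebesgue"
    and pos: "AE x in lebesgue. 0 < w x" and c: "0 < c" and t: "0 < t"
    and adm_c: "cube_avg (\<lambda>x. \<phi> (\<bar>1 / w x\<bar> / c)) (dcube3 Q) \<le> 1"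
    and adm_t: "(\<integral>\<^sup>+x\<in>dcube Q. complementary \<phi> (\<bar>f x * w x\<bar> / t) \<partial>lebesgue) \<le> emeasure lebesgue (dcube Q)"
  shows "(\<integral>\<^sup>+x\<in>dcube Q. ennreal \<bar>f x\<bar> \<partial>lebesgue) \<le> ennreal (2 * c * t) * emeasure lebesgue (dcube3 Q)"
proof -
  note [measurable] = measurable_complementary[of \<phi>]
  define V where "V = 3 ^ CARD('n) * dside (fst Q) ^ CARD('n)"
  have V: "emeasure lebesgue (dcube3 Q) = ennreal V" "0 < V"
    unfolding V_def by (rule emeasure_dcube3) simp
  \<comment> \<open>\<phi> is controlled only on nonnegative arguments, so measurability is derived
    for its composition with the absolute value.\<close>
  have "continuous_on UNIV (\<lambda>x. \<phi> \<bar>x\<bar>)"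
    using \<phi> unfolding young_def
    by (intro continuous_on_compose2[where f = abs and g = \<phi> and t = "{0..}"]) (auto intro: continuous_intros)
  then have \<phi>_meas: "(\<lambda>x. \<phi> \<bar>x\<bar>) \<in> borel_measurable borel"
    by (rule borel_measurable_continuous_onI)
  have "(\<lambda>x. \<phi> \<bar>1 / w x / c\<bar>) \<in> borel_measurable lebesgue"
    by (rule measurable_compose[OF _ \<phi>_meas]) measurable
  then have [measurable]: "(\<lambda>x. \<phi> (\<bar>1 / w x\<bar> / c)) \<in> borel_measurable lebesgue"
    using c by (simp add: abs_divide abs_mult)
  have "(\<integral>\<^sup>+x\<in>dcube Q. ennreal \<bar>f x\<bar> \<partial>lebesgue)
      \<le> (\<integral>\<^sup>+x. ennreal (c * t) * (ennreal (\<phi> (\<bar>1 / w x\<bar> / c)) * indicator (dcube3 Q) x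
          + complementary \<phi> (\<bar>f x * w x\<bar> / t) * indicator (dcube Q) x) \<partial>lebesgue)"
  proof (rule nn_integral_mono_AE)
    show "AE x in lebesgue. ennreal \<bar>f x\<bar> * indicator (dcube Q) x
      \<le> ennreal (c * t) * (ennreal (\<phi> (\<bar>1 / w x\<bar> / c)) * indicator (dcube3 Q) x
          + complementary \<phi> (\<bar>f x * w x\<bar> / t) * indicator (dcube Q) x)"
      using pos
    proof eventually_elim
      fix x assume w: "0 < w x"
      show "ennreal \<bar>f x\<bar> * indicator (dcube Q) x
        \<le> ennreal (c * t) * (ennreal (\<phi> (\<bar>1 / w x\<bar> / c)) * indicator (dcube3 Q) x
            + complementary \<phi> (\<bar>f x * w x\<bar> / t) * indicator (dcube Q) x)"
      proof (cases "x \<in> dcube Q")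
        case True
        then have "x \<in> dcube3 Q" using dcube_subset_dcube3 by blast
        have "\<bar>f x\<bar> = c * t * ((\<bar>1 / w x\<bar> / c) * (\<bar>f x * w x\<bar> / t))"
          using w c t by (simp add: abs_mult)
        then have "ennreal \<bar>f x\<bar> = ennreal (c * t) * ennreal ((\<bar>1 / w x\<bar> / c) * (\<bar>f x * w x\<bar> / t))"
          using c t by (subst ennreal_mult'[symmetric]) auto
        also have "\<dots> \<le> ennreal (c * t) * (ennreal (\<phi> (\<bar>1 / w x\<bar> / c)) + complementary \<phi> (\<bar>f x * w x\<bar> / t))"
          using c by (intro mult_left_mono young_inequality[OF \<phi>]) auto
        finally show ?thesis using True \<open>x \<in> dcube3 Q\<close> by simp
      qed simp
    qed
  qed
  also have "\<dots> = ennreal (c * t) * ((\<integral>\<^sup>+x\<in>dcube3 Q. ennreal (\<phi> (\<bar>1 / w x\<bar> / c)) \<partial>lebesgue)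
      + (\<integral>\<^sup>+x\<in>dcube Q. complementary \<phi> (\<bar>f x * w x\<bar> / t) \<partial>lebesgue))"
    by (subst nn_integral_cmult, measurable, subst nn_integral_add, measurable)
  also have "\<dots> \<le> ennreal (c * t) * (ennreal V + ennreal V)"
  proof (intro mult_left_mono add_mono)
    show "(\<integral>\<^sup>+x\<in>dcube3 Q. ennreal (\<phi> (\<bar>1 / w x\<bar> / c)) \<partial>lebesgue) \<le> ennreal V"
      using adm_c unfolding cube_avg_def V(1) by (simp only: ennreal_divide_le_iff[OF V(2)] mult_1)
    show "(\<integral>\<^sup>+x\<in>dcube Q. complementary \<phi> (\<bar>f x * w x\<bar> / t) \<partial>lebesgue) \<le> ennreal V"
      using adm_t emeasure_mono[OF dcube_subset_dcube3 dcube3_lebesgue, of Q] unfolding V(1) by simp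
  qed simp
  also have "\<dots> = ennreal (2 * c * t) * ennreal V"
    using c t V(2) by (simp add: ennreal_plus[symmetric] ennreal_mult[symmetric] mult_ac del: ennreal_plus)
  finally show ?thesis by (simp only: V(1))
qed

text \<open>Optimise the previous estimate over c, insert the bump condition, then optimise over t.
  Dividing by positive constants turns both claims into lower bounds of an infimum, so an empty set
  of admissible values needs no separate case.\<close>

lemma avg_mult_Lr_avg_le_dlux:
  fixes f u w :: "real ^ 'n \<Rightarrow> real"
  assumes \<phi>: "young \<phi>" and meas: "f \<in> borel_measurable lebesgue" "w \<in> borel_measurable lebesgue"
    and pos: "AE x in lebesgue. 0 < w x" and K: "0 < K"
    and bump: "Lr_avg q u (dcube3 Q) * Luxemburg_avg \<phi> (\<lambda>x. 1 / w x) (dcube3 Q) \<le> ennreal K"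
  shows "(\<integral>\<^sup>+x\<in>dcube Q. ennreal \<bar>f x\<bar> \<partial>lebesgue) / emeasure lebesgue (dcube3 Q) * Lr_avg q u (dcube3 Q)
    \<le> dlux (complementary \<phi>) (\<lambda>x. \<bar>f x * w x\<bar>) Q * ennreal (2 * K)"
proof -
  define X where "X = (\<integral>\<^sup>+x\<in>dcube Q. ennreal \<bar>f x\<bar> \<partial>lebesgue) / emeasure lebesgue (dcube3 Q)"
  define L where "L = Lr_avg q u (dcube3 Q)"
  define V where "V = 3 ^ CARD('n) * dside (fst Q) ^ CARD('n)"
  have V: "emeasure lebesgue (dcube3 Q) = ennreal V" "0 < V"
    unfolding V_def by (rule emeasure_dcube3) simp
  have "X * L / ennreal (2 * K) \<le> dlux (complementary \<phi>) (\<lambda>x. \<bar>f x * w x\<bar>) Q"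
    unfolding dlux_def
  proof (rule Inf_greatest, clarify)
    fix t :: real
    assume t: "0 < t" and adm_t: "(\<integral>\<^sup>+x\<in>dcube Q. complementary \<phi> (\<bar>f x * w x\<bar> / t) \<partial>lebesgue)
      \<le> emeasure lebesgue (dcube Q)"
    have "X / ennreal (2 * t) \<le> Luxemburg_avg \<phi> (\<lambda>x. 1 / w x) (dcube3 Q)"
      unfolding Luxemburg_avg_def
    proof (rule Inf_greatest, clarify)
      fix c :: real
      assume c: "0 < c" and adm_c: "cube_avg (\<lambda>x. \<phi> (\<bar>1 / w x\<bar> / c)) (dcube3 Q) \<le> 1"
      have "X \<le> ennreal (2 * c * t)"
        using cube_avg_dcube3_le[OF \<phi> meas pos c t adm_c adm_t]
        unfolding X_def V(1) by (simp only: ennreal_divide_le_iff[OF V(2)])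
      then show "X / ennreal (2 * t) \<le> ennreal c"
        using c t by (subst ennreal_divide_le_iff) (auto simp: ennreal_mult[symmetric] mult_ac)
    qed
    then have "X \<le> Luxemburg_avg \<phi> (\<lambda>x. 1 / w x) (dcube3 Q) * ennreal (2 * t)"
      using t by (subst (asm) ennreal_divide_le_iff) auto
    then have "X * L \<le> Luxemburg_avg \<phi> (\<lambda>x. 1 / w x) (dcube3 Q) * ennreal (2 * t) * L"
      by (rule mult_right_mono) simp
    also have "\<dots> = ennreal (2 * t) * (L * Luxemburg_avg \<phi> (\<lambda>x. 1 / w x) (dcube3 Q))"
      by (simp add: mult_ac)
    also have "\<dots> \<le> ennreal (2 * t) * ennreal K"
      using bump unfolding L_def by (rule mult_left_mono) simp
    also have "\<dots> = ennreal t * ennreal (2 * K)"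
      using t K by (simp add: ennreal_mult[symmetric] mult_ac)
    finally show "X * L / ennreal (2 * K) \<le> ennreal t"
      using K by (subst ennreal_divide_le_iff) auto
  qed
  then show ?thesis
    using K unfolding X_def L_def by (subst (asm) ennreal_divide_le_iff) auto
qed

section \<open>Sparse families of cubes\<close>

definition dlevel :: "real \<Rightarrow> (real ^ 'n \<Rightarrow> real) \<Rightarrow> real \<Rightarrow> (int \<times> (int ^ 'n)) set" where
  "dlevel \<alpha> f \<kappa> = {Q. ennreal \<kappa> < dfrac \<alpha> f Q}"

lemma dlevel_antimono: "\<kappa> \<le> \<mu> \<Longrightarrow> dlevel \<alpha> f \<mu> \<subseteq> dlevel \<alpha> f \<kappa>"
  unfolding dlevel_def by (auto intro: le_less_trans[OF ennreal_leI])

context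
  fixes f :: "real ^ 'n \<Rightarrow> real" and \<alpha> :: real
  assumes f [measurable]: "f \<in> borel_measurable lebesgue"
    and fin: "(\<integral>\<^sup>+x. ennreal \<bar>f x\<bar> \<partial>lebesgue) < top"
    and \<alpha>: "0 < \<alpha>" "\<alpha> < CARD('n)"
begin

lemma dcube_integral_finite: "(\<integral>\<^sup>+x\<in>dcube Q. ennreal \<bar>f x\<bar> \<partial>lebesgue) < top"
  using fin by (rule le_less_trans[rotated]) (auto intro!: nn_integral_mono simp: indicator_def)

definition mass :: "int \<times> (int ^ 'n) \<Rightarrow> real" where
  "mass Q = enn2real (\<integral>\<^sup>+x\<in>dcube Q. ennreal \<bar>f x\<bar> \<partial>lebesgue)"

lemma mass_nonneg [simp]: "0 \<le> mass Q"
  by (simp add: mass_def)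

lemma ennreal_mass: "(\<integral>\<^sup>+x\<in>dcube Q. ennreal \<bar>f x\<bar> \<partial>lebesgue) = ennreal (mass Q)"
  using dcube_integral_finite[of Q] by (simp add: mass_def)

lemma mass_mono:
  assumes "dcube P \<subseteq> dcube Q"
  shows "mass P \<le> mass Q"
proof -
  have "ennreal (mass P) \<le> ennreal (mass Q)"
    unfolding ennreal_mass[symmetric]
    using assms by (intro nn_integral_mono) (auto simp: indicator_def)
  then show ?thesis by simp
qed

lemma dlevel_iff:
  assumes "0 \<le> \<kappa>"
  shows "Q \<in> dlevel \<alpha> f \<kappa> \<longleftrightarrow> \<kappa> < dside (fst Q) powr (\<alpha> - CARD('n)) * mass Q"
  using assms unfolding dlevel_def dfrac_def ennreal_mass
  by (simp add: ennreal_mult[symmetric] ennreal_less_iff)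

text \<open>On a cube of side s the fractional average is at most s^(\<alpha> - n) times the full
  integral of |f|, which is finite, and \<alpha> < n. This bound on the scales is what makes maximal
  cubes exist at each positive level.\<close>

lemma dlevel_bounded:
  assumes "0 < \<kappa>"
  obtains B where "\<And>Q. Q \<in> dlevel \<alpha> f \<kappa> \<Longrightarrow> fst Q \<le> B"
proof -
  let ?n = "real CARD('n)"
  define I where "I = enn2real (\<integral>\<^sup>+x. ennreal \<bar>f x\<bar> \<partial>lebesgue)"
  have I: "mass Q \<le> I" for Q
    unfolding mass_def I_def using fin
    by (intro enn2real_mono) (auto intro!: nn_integral_mono simp: indicator_def)
  have "0 \<le> I" by (simp add: I_def)
  \<comment> \<open>The summand 1 keeps the logarithm meaningful when the integral of |f| is
    0.\<close>
  define B where "B = \<lceil>log 2 (I / \<kappa> + 1) / (?n - \<alpha>)\<rceil>"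
  show ?thesis
  proof (rule that[of B])
    fix Q assume "Q \<in> dlevel \<alpha> f \<kappa>"
    then have "\<kappa> < dside (fst Q) powr (\<alpha> - ?n) * mass Q"
      using assms by (simp add: dlevel_iff)
    also have "\<dots> \<le> dside (fst Q) powr (\<alpha> - ?n) * I"
      using I by (intro mult_left_mono) auto
    finally have "\<kappa> * dside (fst Q) powr (?n - \<alpha>) < dside (fst Q) powr (\<alpha> - ?n) * I * dside (fst Q) powr (?n - \<alpha>)"
      by (rule mult_strict_right_mono) simp
    also have "\<dots> = I"
      using powr_add[of "dside (fst Q)" "\<alpha> - ?n" "?n - \<alpha>"] by (simp add: mult_ac)
    finally have "dside (fst Q) powr (?n - \<alpha>) < I / \<kappa>"
      using assms by (simp add: field_simps)
    then have "2 powr (of_int (fst Q) * (?n - \<alpha>)) \<le> I / \<kappa> + 1"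
      by (simp add: dside_def powr_powr)
    then have "of_int (fst Q) * (?n - \<alpha>) \<le> log 2 (I / \<kappa> + 1)"
      using \<open>0 \<le> I\<close> assms by (subst le_log_iff) (auto intro: add_nonneg_pos)
    then have "of_int (fst Q) \<le> log 2 (I / \<kappa> + 1) / (?n - \<alpha>)"
      using \<alpha> by (simp add: field_simps)
    then show "fst Q \<le> B" unfolding B_def by linarith
  qed
qed

text \<open>The parent of a maximal cube at level \<open>\<kappa>\<close> is not selected, so its average bounds that of
  the cube from above; the cubes selected at the level \<open>2 powr (n + 1) * \<kappa>\<close> therefore fill at
  most half of it.\<close>

lemma sparse_levels:
  assumes \<kappa>: "0 < \<kappa>" and Q: "Q \<in> maximal_dcubes (dlevel \<alpha> f \<kappa>)"
  shows "emeasure lebesgue (dcube Q)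
    \<le> 2 * emeasure lebesgue (dcube Q - (\<Union>R\<in>dlevel \<alpha> f (2 powr (CARD('n) + 1) * \<kappa>). dcube R))"
proof -
  let ?n = "real CARD('n)"
  define \<mu> where "\<mu> = 2 powr (?n + 1) * \<kappa>"
  have "1 * \<kappa> \<le> \<mu>"
    unfolding \<mu>_def using \<kappa> by (intro mult_right_mono ge_one_powr_ge_zero) auto
  then have \<mu>: "\<kappa> \<le> \<mu>" "0 < \<mu>" using \<kappa> by auto
  define s where "s = dside (fst Q)"
  have s: "0 < s" by (simp add: s_def)
  define U where "U = (\<Union>R\<in>dlevel \<alpha> f \<mu>. dcube R)"
  have [measurable]: "U \<in> sets lebesgue"
    unfolding U_def by (intro sets.countable_UN'') auto
  obtain x where x: "x \<in> dcube Q" using dcube_nonempty by blast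
  \<comment> \<open>P is the dyadic parent of Q. It meets Q at a larger scale, so the maximality of
    Q keeps it out of the level family.\<close>
  define P where "P = (fst Q + 1, dindex (fst Q + 1) x)"
  have xP: "x \<in> dcube P" by (simp add: P_def)
  then have "dcube Q \<inter> dcube P \<noteq> {}" using x by blast
  then have "P \<notin> dlevel \<alpha> f \<kappa>"
    using Q unfolding maximal_dcubes_def by (auto simp: P_def)
  then have "(2 * s) powr (\<alpha> - ?n) * mass P \<le> \<kappa>"
    using \<kappa> by (simp add: dlevel_iff P_def dside_Suc s_def)
  then have "(2 * s) powr (\<alpha> - ?n) * mass P * (2 * s) powr (?n - \<alpha>) \<le> \<kappa> * (2 * s) powr (?n - \<alpha>)"
    by (rule mult_right_mono) simp
  moreover have "(2 * s) powr (\<alpha> - ?n) * mass P * (2 * s) powr (?n - \<alpha>) = mass P"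
    using powr_add[of "2 * s" "\<alpha> - ?n" "?n - \<alpha>"] s by (simp add: mult_ac)
  ultimately have "mass P \<le> \<kappa> * (2 * s) powr (?n - \<alpha>)" by simp
  moreover have "mass Q \<le> mass P"
    using x xP by (intro mass_mono dcube_subset[of Q P x]) (auto simp: P_def)
  ultimately have massQ: "mass Q \<le> \<kappa> * (2 * s) powr (?n - \<alpha>)" by simp
  define G where "G = {R \<in> dlevel \<alpha> f \<mu>. dcube R \<inter> dcube Q \<noteq> {}}"
  \<comment> \<open>A cube at the higher level is also at level \<kappa>, so if it meets the maximal
    cube Q it lies inside Q. Only the mass of \<open>f\<close> on Q is therefore relevant
    below.\<close>
  have GQ: "fst R \<le> fst Q" "dcube R \<subseteq> dcube Q" if "R \<in> G" for R
  proof -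
    have R: "R \<in> dlevel \<alpha> f \<kappa>" "dcube Q \<inter> dcube R \<noteq> {}"
      using that dlevel_antimono[OF \<mu>(1)] by (auto simp: G_def)
    then show le: "fst R \<le> fst Q"
      using Q by (auto simp: maximal_dcubes_def)
    from R(2) obtain y where "y \<in> dcube R" "y \<in> dcube Q" by blast
    then show "dcube R \<subseteq> dcube Q" using le by (intro dcube_subset)
  qed
  have "dcube Q \<inter> U \<subseteq> (\<Union>R\<in>G. dcube R)"
    unfolding U_def G_def by blast
  then have "emeasure lebesgue (dcube Q \<inter> U) \<le> emeasure lebesgue (\<Union>R\<in>G. dcube R)"
    by (rule emeasure_mono) (intro sets.countable_UN'', auto)
  also have "\<dots> \<le> (\<integral>\<^sup>+y. ennreal (s powr \<alpha> / \<mu>) * (ennreal \<bar>f y\<bar> * indicator (dcube Q) y) \<partial>lebesgue)"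
  proof (rule emeasure_UN_dcube_le)
    fix R assume R: "R \<in> G"
    define r where "r = dside (fst R)"
    have r: "0 < r" "r \<le> s"
      unfolding r_def s_def using GQ[OF R] by (auto intro: dside_mono)
    have "\<mu> < r powr (\<alpha> - ?n) * mass R"
      using R \<mu> by (simp add: G_def dlevel_iff r_def)
    then have "\<mu> * r powr ?n \<le> r powr (\<alpha> - ?n) * mass R * r powr ?n"
      by (intro mult_right_mono) auto
    also have "\<dots> = r powr \<alpha> * mass R"
      using powr_add[of r "\<alpha> - ?n" ?n] by (simp add: mult_ac)
    also have "\<dots> \<le> s powr \<alpha> * mass R"
      using r \<alpha> by (intro mult_right_mono powr_mono2) auto
    finally have "r ^ CARD('n) \<le> s powr \<alpha> / \<mu> * mass R"
      using \<mu> r by (simp add: powr_realpow field_simps)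
    then have "emeasure lebesgue (dcube R) \<le> ennreal (s powr \<alpha> / \<mu>) * ennreal (mass R)"
      unfolding emeasure_dcube r_def using \<mu> by (subst ennreal_mult[symmetric]) (auto intro: ennreal_leI)
    also have "\<dots> = ennreal (s powr \<alpha> / \<mu>) * (\<integral>\<^sup>+y. ennreal \<bar>f y\<bar> * indicator (dcube R) y \<partial>lebesgue)"
      by (simp add: ennreal_mass)
    also have "\<dots> = (\<integral>\<^sup>+y. ennreal (s powr \<alpha> / \<mu>) * (ennreal \<bar>f y\<bar> * indicator (dcube R) y) \<partial>lebesgue)"
      by (rule nn_integral_cmult[symmetric]) measurable
    also have "\<dots> = (\<integral>\<^sup>+y\<in>dcube R. ennreal (s powr \<alpha> / \<mu>) * (ennreal \<bar>f y\<bar> * indicator (dcube Q) y) \<partial>lebesgue)"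
      using GQ(2)[OF R] by (intro nn_integral_cong) (auto simp: indicator_def)
    finally show "emeasure lebesgue (dcube R)
      \<le> (\<integral>\<^sup>+y\<in>dcube R. ennreal (s powr \<alpha> / \<mu>) * (ennreal \<bar>f y\<bar> * indicator (dcube Q) y) \<partial>lebesgue)" .
  qed measurable
  also have "\<dots> = ennreal (s powr \<alpha> / \<mu>) * ennreal (mass Q)"
    unfolding ennreal_mass[symmetric] by (rule nn_integral_cmult) measurable
  also have "\<dots> \<le> ennreal (s ^ CARD('n) / 2)"
  proof -
    \<comment> \<open>Here the factor 2^(n+1) in \<mu> is used up: 2^(n-\<alpha>) from the parent
      divided by 2^(n+1) is 2^(-\<alpha>-1), at most 1/2.\<close>
    have "s powr \<alpha> / \<mu> * mass Q \<le> s powr \<alpha> / \<mu> * (\<kappa> * (2 * s) powr (?n - \<alpha>))"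
      using massQ \<mu> by (intro mult_left_mono) auto
    also have "\<dots> = s powr \<alpha> * s powr (?n - \<alpha>) * (2 powr (?n - \<alpha>) / 2 powr (?n + 1))"
      using \<kappa> s by (simp add: \<mu>_def powr_mult)
    also have "\<dots> = s ^ CARD('n) * 2 powr (- \<alpha> - 1)"
      using s by (simp add: powr_add[symmetric] powr_diff[symmetric] powr_realpow)
    also have "\<dots> \<le> s ^ CARD('n) * 2 powr (- 1)"
      using s \<alpha> by (intro mult_left_mono powr_mono) auto
    also have "\<dots> = s ^ CARD('n) / 2"
      by (simp add: powr_minus)
    finally show ?thesis
      using \<mu> s by (subst ennreal_mult[symmetric]) (auto intro: ennreal_leI)
  qed
  finally have half: "emeasure lebesgue (dcube Q \<inter> U) \<le> ennreal (s ^ CARD('n) / 2)" .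
  define e where "e = emeasure lebesgue (dcube Q - U)"
  have "emeasure lebesgue (dcube Q) = emeasure lebesgue (dcube Q \<inter> U) + e"
    using plus_emeasure[of "dcube Q \<inter> U" lebesgue "dcube Q - U"]
    unfolding e_def by (simp only: Int_Diff_Un Int_Diff_disjoint sets.Int sets.Diff dcube_lebesgue
        \<open>U \<in> sets lebesgue\<close> simp_thms)
  then have *: "ennreal (s ^ CARD('n)) \<le> ennreal (s ^ CARD('n) / 2) + e"
    using half unfolding emeasure_dcube s_def by (simp add: add_right_mono)
  have "ennreal (s ^ CARD('n)) \<le> 2 * e"
  proof (cases e rule: ennreal_cases)
    case (real d)
    have "ennreal (s ^ CARD('n)) \<le> ennreal (s ^ CARD('n) / 2 + d)"
      using * real s by (subst ennreal_plus) auto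
    then have "s ^ CARD('n) \<le> s ^ CARD('n) / 2 + d"
      using real s by (subst (asm) ennreal_le_iff) auto
    then show ?thesis
      using real by (simp add: numeral_mult_ennreal ennreal_leI)
  qed auto
  then show ?thesis
    unfolding e_def U_def \<mu>_def emeasure_dcube s_def by (simp add: add.commute)
qed

end

section \<open>Summation over the sparse family\<close>

text \<open>The weights enter only through the testing inequality \<open>test\<close> on single
  cubes. Sparseness then trades |Q| for the measure of a disjoint part of Q, on which N Q may be
  replaced by the function M.\<close>

lemma nn_integral_dfrac_max_le_integrable:
  fixes f :: "real ^ 'n \<Rightarrow> real" and v M :: "real ^ 'n \<Rightarrow> ennreal"
    and N :: "int \<times> (int ^ 'n) \<Rightarrow> ennreal" and C :: ennreal and \<alpha> p q :: real
  assumes f [measurable]: "f \<in> borel_measurable lebesgue"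
    and fin: "(\<integral>\<^sup>+x. ennreal \<bar>f x\<bar> \<partial>lebesgue) < top"
    and \<alpha>: "0 < \<alpha>" "\<alpha> < CARD('n)" and pq: "0 < p" "p \<le> q"
    and [measurable]: "v \<in> borel_measurable lebesgue" "M \<in> borel_measurable lebesgue"
    and NM: "\<And>Q x. x \<in> dcube Q \<Longrightarrow> N Q \<le> M x"
    and test: "\<And>Q. epowr (dfrac \<alpha> f Q) q * (\<integral>\<^sup>+x\<in>dcube3 Q. v x \<partial>lebesgue)
      \<le> C * epowr (emeasure lebesgue (dcube Q) * epowr (N Q) p) (q / p)"
  shows "(\<integral>\<^sup>+x. epowr (dfrac_max \<alpha> f x) q * v x \<partial>lebesgue)
    \<le> ennreal (2 powr ((CARD('n) + 1) * q)) * C * epowr (2 * (\<integral>\<^sup>+x. epowr (M x) p \<partial>lebesgue)) (q / p)"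
proof -
  define a :: real where "a = 2 powr (CARD('n) + 1)"
  have a: "1 < a" by (simp add: a_def)
  have q: "0 < q" using pq by simp
  define S where "S k = maximal_dcubes (dlevel \<alpha> f (a powr of_int k))" for k :: int
  define V where "V Q = (\<integral>\<^sup>+x\<in>dcube3 Q. v x \<partial>lebesgue)" for Q :: "int \<times> (int ^ 'n)"
  let ?g = "\<lambda>k::int. ennreal (a powr ((of_int k + 1) * q))"
  let ?I = "UNIV :: (int \<times> int \<times> (int ^ 'n)) set"
  \<comment> \<open>The index is a pair of level and cube, because one cube may be selected at
    several levels.\<close>
  define T where "T i = of_bool (snd i \<in> S (fst i)) * (emeasure lebesgue (dcube (snd i)) * epowr (N (snd i)) p)"
    for i :: "int \<times> int \<times> (int ^ 'n)"
  \<comment> \<open>A cube P with large average whose triple contains x lies in a selected cube Q,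
    and by \<open>dcube3_mono\<close> the triple of Q contains x too.\<close>
  have cover: "\<exists>Q\<in>S k. x \<in> dcube3 Q" if lev: "ennreal (a powr of_int k) < dfrac_max \<alpha> f x" for x k
  proof -
    obtain P where "ennreal (a powr of_int k) < dfrac \<alpha> f P * indicator (dcube3 P) x"
      using lev unfolding dfrac_max_def less_SUP_iff by blast
    then have P: "P \<in> dlevel \<alpha> f (a powr of_int k)" "x \<in> dcube3 P"
      by (cases "x \<in> dcube3 P"; simp add: dlevel_def)+
    have "0 < a powr of_int k" using a by simp
    from dlevel_bounded[OF f fin \<alpha> this] obtain B
      where "\<And>Q. Q \<in> dlevel \<alpha> f (a powr of_int k) \<Longrightarrow> fst Q \<le> B" by blast
    from maximal_dcubes_cover[OF this P(1)] obtain Q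
      where Q: "Q \<in> S k" "fst P \<le> fst Q" "dcube P \<subseteq> dcube Q" unfolding S_def by blast
    then show ?thesis using P(2) dcube3_mono[OF Q(2,3)] by blast
  qed
  have "(\<integral>\<^sup>+x. epowr (dfrac_max \<alpha> f x) q * v x \<partial>lebesgue)
      \<le> (\<integral>\<^sup>+x. (\<integral>\<^sup>+i. ?g (fst i) * of_bool (snd i \<in> S (fst i)) * (v x * indicator (dcube3 (snd i)) x) \<partial>count_space ?I) \<partial>lebesgue)"
  proof (rule nn_integral_mono)
    fix x
    have "epowr (dfrac_max \<alpha> f x) q
        \<le> (\<integral>\<^sup>+k. ?g k * of_bool (ennreal (a powr of_int k) < dfrac_max \<alpha> f x) \<partial>count_space UNIV)"
      by (rule epowr_le_layers[OF a q])
    also have "\<dots> \<le> (\<integral>\<^sup>+k. (\<integral>\<^sup>+Q. ?g k * of_bool (Q \<in> S k) * indicator (dcube3 Q) x \<partial>count_space UNIV) \<partial>count_space UNIV)"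
    proof (rule nn_integral_mono)
      fix k :: int
      show "?g k * of_bool (ennreal (a powr of_int k) < dfrac_max \<alpha> f x)
        \<le> (\<integral>\<^sup>+Q. ?g k * of_bool (Q \<in> S k) * indicator (dcube3 Q) x \<partial>count_space UNIV)"
      proof (cases "ennreal (a powr of_int k) < dfrac_max \<alpha> f x")
        case True
        from cover[OF True] obtain Q where Q: "Q \<in> S k" "x \<in> dcube3 Q" by blast
        have "?g k * of_bool (ennreal (a powr of_int k) < dfrac_max \<alpha> f x)
            = ?g k * of_bool (Q \<in> S k) * indicator (dcube3 Q) x"
          using Q True by simp
        also have "\<dots> \<le> (\<integral>\<^sup>+Q. ?g k * of_bool (Q \<in> S k) * indicator (dcube3 Q) x \<partial>count_space UNIV)"
          by (rule nn_integral_ge_point) simp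
        finally show ?thesis .
      qed simp
    qed
    also have "\<dots> = (\<integral>\<^sup>+i. ?g (fst i) * of_bool (snd i \<in> S (fst i)) * indicator (dcube3 (snd i)) x \<partial>count_space ?I)"
      using nn_integral_fst_count_space[of "\<lambda>i. ?g (fst i) * of_bool (snd i \<in> S (fst i)) * indicator (dcube3 (snd i)) x"]
      by simp
    finally have "epowr (dfrac_max \<alpha> f x) q * v x
        \<le> (\<integral>\<^sup>+i. ?g (fst i) * of_bool (snd i \<in> S (fst i)) * indicator (dcube3 (snd i)) x \<partial>count_space ?I) * v x"
      by (rule mult_right_mono) simp
    also have "\<dots> = (\<integral>\<^sup>+i. ?g (fst i) * of_bool (snd i \<in> S (fst i)) * indicator (dcube3 (snd i)) x * v x \<partial>count_space ?I)"
      by (rule nn_integral_multc[symmetric]) simp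
    finally show "epowr (dfrac_max \<alpha> f x) q * v x
      \<le> (\<integral>\<^sup>+i. ?g (fst i) * of_bool (snd i \<in> S (fst i)) * (v x * indicator (dcube3 (snd i)) x) \<partial>count_space ?I)"
      by (simp only: mult_ac)
  qed
  also have "\<dots> = (\<integral>\<^sup>+i. (\<integral>\<^sup>+x. ?g (fst i) * of_bool (snd i \<in> S (fst i)) * (v x * indicator (dcube3 (snd i)) x) \<partial>lebesgue) \<partial>count_space ?I)"
    by (rule nn_integral_count_space_nn_integral) simp_all
  also have "\<dots> = (\<integral>\<^sup>+i. ?g (fst i) * of_bool (snd i \<in> S (fst i)) * V (snd i) \<partial>count_space ?I)"
    unfolding V_def by (intro nn_integral_cong nn_integral_cmult) measurable
  also have "\<dots> \<le> (\<integral>\<^sup>+i. ennreal (a powr q) * C * epowr (T i) (q / p) \<partial>count_space ?I)"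
  proof (rule nn_integral_mono)
    fix i :: "int \<times> int \<times> (int ^ 'n)"
    obtain k Q where i: "i = (k, Q)" by (cases i)
    show "?g (fst i) * of_bool (snd i \<in> S (fst i)) * V (snd i) \<le> ennreal (a powr q) * C * epowr (T i) (q / p)"
    proof (cases "Q \<in> S k")
      case True
      then have "ennreal (a powr of_int k) \<le> dfrac \<alpha> f Q"
        by (auto simp: S_def maximal_dcubes_def dlevel_def intro: less_imp_le)
      then have "epowr (ennreal (a powr of_int k)) q \<le> epowr (dfrac \<alpha> f Q) q"
        using q by (intro epowr_mono) auto
      then have *: "ennreal (a powr (of_int k * q)) \<le> epowr (dfrac \<alpha> f Q) q"
        by (simp add: epowr_ennreal powr_powr)
      have "?g k = ennreal (a powr q) * ennreal (a powr (of_int k * q))"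
        by (simp add: ennreal_mult[symmetric] powr_add[symmetric] algebra_simps)
      then have "?g k * V Q \<le> ennreal (a powr q) * (epowr (dfrac \<alpha> f Q) q * V Q)"
        using * by (simp add: mult.assoc mult_left_mono mult_right_mono)
      also have "\<dots> \<le> ennreal (a powr q) * (C * epowr (T i) (q / p))"
        using test[of Q] True by (intro mult_left_mono) (auto simp: i T_def V_def)
      finally show ?thesis using True by (simp add: i mult.assoc)
    qed (simp add: i)
  qed
  also have "\<dots> = ennreal (a powr q) * C * (\<integral>\<^sup>+i. epowr (T i) (q / p) \<partial>count_space ?I)"
    by (rule nn_integral_cmult) simp
  \<comment> \<open>The only place where p <= q matters: with q/p >= 1 the power can be taken
    outside the sum.\<close>
  also have "\<dots> \<le> ennreal (a powr q) * C * epowr (\<integral>\<^sup>+i. T i \<partial>count_space ?I) (q / p)"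
    using pq by (intro mult_left_mono epowr_sum_le) auto
  also have "\<dots> \<le> ennreal (a powr q) * C * epowr (2 * (\<integral>\<^sup>+x. epowr (M x) p \<partial>lebesgue)) (q / p)"
  proof (intro mult_left_mono epowr_mono)
    define K where "K = {i. snd i \<in> S (fst i)}"
    \<comment> \<open>The part of a selected cube not covered by any cube of the next level;
      \<open>sparse_levels\<close> gives it at least half of the measure.\<close>
    define E where "E i = dcube (snd i) - (\<Union>R\<in>dlevel \<alpha> f (a powr (of_int (fst i) + 1)). dcube R)"
      for i :: "int \<times> int \<times> (int ^ 'n)"
    have E_meas: "E i \<in> sets lebesgue" for i
      unfolding E_def by (intro sets.Diff sets.countable_UN'') auto
    have "(\<integral>\<^sup>+i. T i \<partial>count_space ?I)
        \<le> (\<integral>\<^sup>+i. 2 * (\<integral>\<^sup>+x\<in>E i. epowr (M x) p \<partial>lebesgue) * indicator K i \<partial>count_space ?I)"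
    proof (rule nn_integral_mono)
      fix i :: "int \<times> int \<times> (int ^ 'n)"
      obtain k Q where i: "i = (k, Q)" by (cases i)
      show "T i \<le> 2 * (\<integral>\<^sup>+x\<in>E i. epowr (M x) p \<partial>lebesgue) * indicator K i"
      proof (cases "Q \<in> S k")
        case True
        have ak: "2 powr (CARD('n) + 1) * a powr of_int k = a powr (of_int k + 1)"
          by (simp add: a_def powr_add)
        have "emeasure lebesgue (dcube Q) \<le> 2 * emeasure lebesgue (E i)"
          using sparse_levels[OF f fin \<alpha>, of "a powr of_int k" Q] True a
          unfolding ak by (simp add: S_def E_def i)
        then have "emeasure lebesgue (dcube Q) * epowr (N Q) p \<le> 2 * emeasure lebesgue (E i) * epowr (N Q) p"
          by (rule mult_right_mono) simp
        also have "\<dots> = 2 * (\<integral>\<^sup>+x. epowr (N Q) p * indicator (E i) x \<partial>lebesgue)"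
          by (subst nn_integral_cmult_indicator[OF E_meas]) (simp add: mult_ac)
        also have "\<dots> \<le> 2 * (\<integral>\<^sup>+x\<in>E i. epowr (M x) p \<partial>lebesgue)"
          using NM[of _ Q] pq
          by (intro mult_left_mono nn_integral_mono) (auto simp: indicator_def E_def i intro!: epowr_mono)
        finally show ?thesis using True by (simp add: T_def K_def i)
      qed (simp add: T_def i)
    qed
    also have "\<dots> = (\<integral>\<^sup>+i. 2 * (\<integral>\<^sup>+x\<in>E i. epowr (M x) p \<partial>lebesgue) \<partial>count_space K)"
      by (rule nn_integral_count_space_indicator[symmetric]) simp
    also have "\<dots> = 2 * (\<integral>\<^sup>+i. (\<integral>\<^sup>+x\<in>E i. epowr (M x) p \<partial>lebesgue) \<partial>count_space K)"
      by (rule nn_integral_cmult) simp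
    also have "\<dots> \<le> 2 * (\<integral>\<^sup>+x. epowr (M x) p \<partial>lebesgue)"
    proof (intro mult_left_mono nn_integral_disjoint_family_le)
      show "disjoint_family_on E K"
        unfolding disjoint_family_on_def
      proof (intro ballI impI)
        \<comment> \<open>A cube selected at a higher level l belongs to the level family k + 1 as
          well, so it was removed when E was formed at level k.\<close>
        have sep: "E (k, P) \<inter> E (l, Q) = {}" if "k < l" "Q \<in> S l" for k l P Q
        proof -
          have "a powr (of_int k + 1) \<le> a powr of_int l"
            using that(1) a by (intro powr_mono) auto
          from dlevel_antimono[OF this] have "Q \<in> dlevel \<alpha> f (a powr (of_int k + 1))"
            using that(2) by (auto simp: S_def maximal_dcubes_def)
          then show ?thesis by (auto simp: E_def)
        qed
        fix i j assume ij: "i \<in> K" "j \<in> K" "i \<noteq> j"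
        obtain k P where i: "i = (k, P)" by (cases i)
        obtain l Q where j: "j = (l, Q)" by (cases j)
        consider "k < l" | "l < k" | "k = l" by linarith
        then show "E i \<inter> E j = {}"
        proof cases
          case 1
          then show ?thesis using sep[of k l Q P] ij by (simp add: i j K_def)
        next
          case 2
          then show ?thesis using sep[of l k P Q] ij by (simp add: i j K_def Int_commute)
        next
          case 3
          then have "P \<in> S k" "Q \<in> S k" "P \<noteq> Q" using ij by (auto simp: i j K_def)
          then have "dcube P \<inter> dcube Q = {}"
            using disjoint_maximal_dcubes unfolding S_def disjoint_family_on_def by blast
          then show ?thesis by (auto simp: E_def i j)
        qed
      qed
    qed (use E_meas in auto)
    finally show "(\<integral>\<^sup>+i. T i \<partial>count_space ?I) \<le> 2 * (\<integral>\<^sup>+x. epowr (M x) p \<partial>lebesgue)" .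
  qed (use pq in auto)
  also have "a powr q = 2 powr ((CARD('n) + 1) * q)"
    by (simp add: a_def powr_powr)
  finally show ?thesis .
qed

section \<open>Linear change of variables\<close>

text \<open>The restriction to sides at most 1 guarantees that maximal cubes exist, even when U is
  the whole space.\<close>

lemma open_dcube_cover:
  fixes U :: "(real ^ 'n) set"
  assumes "open U"
  shows "U = (\<Union>Q\<in>{Q. fst Q \<le> 0 \<and> dcube Q \<subseteq> U}. dcube Q)"
proof
  show "U \<subseteq> (\<Union>Q\<in>{Q. fst Q \<le> 0 \<and> dcube Q \<subseteq> U}. dcube Q)"
  proof
    fix x assume "x \<in> U"
    then obtain e where e: "0 < e" "ball x e \<subseteq> U"
      using assms open_contains_ball by blast
    \<comment> \<open>N is chosen so that n times the side is below e; the l^1 norm then keeps the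
      cube inside the ball.\<close>
    obtain N :: nat where N: "CARD('n) / e < 2 ^ N"
      using real_arch_pow[of 2] by auto
    define s where "s = dside (- int N)"
    have s: "CARD('n) * s < e"
      using N e(1) by (simp add: s_def dside_def powr_minus powr_realpow field_simps)
    have "dcube (- int N, dindex (- int N) x) \<subseteq> ball x e"
    proof
      fix y assume y: "y \<in> dcube (- int N, dindex (- int N) x)"
      have "\<bar>(x - y) $ i\<bar> \<le> s" for i
        using y dcube_dindex[of x "- int N"] unfolding mem_dcube
        by (auto simp: s_def[symmetric] algebra_simps abs_le_iff dest!: spec[of _ i])
      then have "(\<Sum>i\<in>UNIV. \<bar>(x - y) $ i\<bar>) \<le> (\<Sum>i\<in>(UNIV :: 'n set). s)"
        by (intro sum_mono) auto
      then have "norm (x - y) < e"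
        using norm_le_l1_cart[of "x - y"] s by simp
      then show "y \<in> ball x e" by (simp add: dist_norm)
    qed
    then have "(- int N, dindex (- int N) x) \<in> {Q. fst Q \<le> 0 \<and> dcube Q \<subseteq> U}"
      using e(2) by auto
    then show "x \<in> (\<Union>Q\<in>{Q. fst Q \<le> 0 \<and> dcube Q \<subseteq> U}. dcube Q)"
      using dcube_dindex by blast
  qed
qed blast

lemma lebesgue_matrix_image:
  fixes A :: "real ^ 'n ^ 'n"
  assumes "S \<in> sets lebesgue"
  shows "(*v) A ` S \<in> sets lebesgue"
  by (rule differentiable_image_in_sets_lebesgue[OF assms])
     (auto intro!: linear_imp_differentiable_on matrix_vector_mul_linear)

text \<open>\<kappa> bounds A in the maximum norm: if every coordinate changes by at most s, every
  coordinate of the image changes by at most \<kappa> s. So the image lies in a cube of side 2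
  \<kappa> s centred at the image of one point of Q.\<close>

lemma matrix_image_dcube:
  fixes A :: "real ^ 'n ^ 'n"
  defines "\<kappa> \<equiv> \<Sum>i\<in>UNIV. \<Sum>j\<in>UNIV. \<bar>A $ i $ j\<bar>"
  shows "emeasure lebesgue ((*v) A ` dcube Q) \<le> ennreal ((2 * \<kappa>) ^ CARD('n)) * emeasure lebesgue (dcube Q)"
proof -
  have \<kappa>: "0 \<le> \<kappa>" unfolding \<kappa>_def by (intro sum_nonneg) auto
  obtain x where x: "x \<in> dcube Q" using dcube_nonempty by blast
  define s where "s = dside (fst Q)"
  define a where "a = A *v x - vec (\<kappa> * s)"
  have s: "0 < s" by (simp add: s_def)
  have "(*v) A ` dcube Q \<subseteq> cbox a (a + vec (2 * \<kappa> * s))"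
  proof clarify
    fix y assume y: "y \<in> dcube Q"
    have d: "\<bar>y $ j - x $ j\<bar> \<le> s" for j
      using x y by (cases Q) (auto simp: s_def mem_dcube algebra_simps abs_le_iff dest!: spec[of _ j])
    have "\<bar>(A *v y) $ i - (A *v x) $ i\<bar> \<le> \<kappa> * s" for i
    proof -
      have "(A *v y) $ i - (A *v x) $ i = (\<Sum>j\<in>UNIV. A $ i $ j * (y $ j - x $ j))"
        by (simp add: matrix_vector_mult_def sum_subtractf[symmetric] right_diff_distrib)
      also have "\<bar>\<dots>\<bar> \<le> (\<Sum>j\<in>UNIV. \<bar>A $ i $ j * (y $ j - x $ j)\<bar>)"
        by (rule sum_abs)
      also have "\<dots> \<le> (\<Sum>j\<in>UNIV. \<bar>A $ i $ j\<bar> * s)"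
        using d by (intro sum_mono) (auto simp: abs_mult intro: mult_left_mono)
      also have "\<dots> = (\<Sum>j\<in>UNIV. \<bar>A $ i $ j\<bar>) * s"
        by (simp add: sum_distrib_right)
      also have "\<dots> \<le> \<kappa> * s"
        unfolding \<kappa>_def using s
        by (intro mult_right_mono member_le_sum[of i _ "\<lambda>i. \<Sum>j\<in>UNIV. \<bar>A $ i $ j\<bar>"]) (auto intro: sum_nonneg)
      finally show ?thesis .
    qed
    then show "A *v y \<in> cbox a (a + vec (2 * \<kappa> * s))"
      by (simp add: mem_box_cart a_def abs_le_iff) (smt (verit))
  qed
  then have "emeasure lebesgue ((*v) A ` dcube Q) \<le> emeasure lebesgue (cbox a (a + vec (2 * \<kappa> * s)))"
    by (rule emeasure_mono) simp
  also have "\<dots> = ennreal ((2 * \<kappa> * s) ^ CARD('n))"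
    using \<kappa> s by (simp add: emeasure_cbox_vec)
  also have "\<dots> = ennreal ((2 * \<kappa>) ^ CARD('n)) * emeasure lebesgue (dcube Q)"
    unfolding emeasure_dcube s_def[symmetric] using \<kappa> s
    by (subst ennreal_mult[symmetric]) (auto simp: power_mult_distrib)
  finally show ?thesis .
qed

text \<open>The library proves this with the determinant as constant, but only for a well-ordered index
  type. Some constant is enough here, and covering open sets by disjoint dyadic cubes gives one.\<close>

lemma emeasure_matrix_image_le:
  fixes A :: "real ^ 'n ^ 'n"
  assumes inj: "inj ((*v) A)"
  obtains c where "0 \<le> c"
    "\<And>S. S \<in> sets lebesgue \<Longrightarrow> emeasure lebesgue ((*v) A ` S) \<le> ennreal c * emeasure lebesgue S"
proof
  define c where "c = (2 * (\<Sum>i\<in>UNIV. \<Sum>j\<in>UNIV. \<bar>A $ i $ j\<bar>)) ^ CARD('n)"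
  show "0 \<le> c"
    unfolding c_def by (intro zero_le_power mult_nonneg_nonneg sum_nonneg) auto
  have cube: "emeasure lebesgue ((*v) A ` dcube Q) \<le> ennreal c * emeasure lebesgue (dcube Q)" for Q
    unfolding c_def by (rule matrix_image_dcube)
  have op: "emeasure lebesgue ((*v) A ` U) \<le> ennreal c * emeasure lebesgue U" if U: "open U" for U
  proof -
    define F where "F = {Q :: int \<times> (int ^ 'n). fst Q \<le> 0 \<and> dcube Q \<subseteq> U}"
    define G where "G = maximal_dcubes F"
    have bd: "fst Q \<le> 0" if "Q \<in> F" for Q using that by (simp add: F_def)
    have GF: "G \<subseteq> F" by (auto simp: G_def maximal_dcubes_def)
    have eq: "U = (\<Union>Q\<in>G. dcube Q)"
    proof
      show "U \<subseteq> (\<Union>Q\<in>G. dcube Q)"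
      proof
        fix x assume "x \<in> U"
        then obtain P where P: "P \<in> F" "x \<in> dcube P"
          using open_dcube_cover[OF U] unfolding F_def by blast
        obtain Q where "Q \<in> G" "dcube P \<subseteq> dcube Q"
          unfolding G_def by (rule maximal_dcubes_cover[OF bd P(1)]) auto
        then show "x \<in> (\<Union>Q\<in>G. dcube Q)" using P(2) by blast
      qed
    qed (use GF in \<open>auto simp: F_def\<close>)
    have disj: "disjoint_family_on dcube G"
      unfolding G_def by (rule disjoint_maximal_dcubes)
    \<comment> \<open>Injectivity keeps the images disjoint, so the measure of their union is still
      the sum.\<close>
    then have disj': "disjoint_family_on (\<lambda>Q. (*v) A ` dcube Q) G"
      unfolding disjoint_family_on_def by (simp add: image_Int[OF inj, symmetric])
    have count: "countable G" by simp
    have "(*v) A ` U = (\<Union>Q\<in>G. (*v) A ` dcube Q)"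
      by (subst eq) blast
    then have "emeasure lebesgue ((*v) A ` U) = (\<integral>\<^sup>+Q. emeasure lebesgue ((*v) A ` dcube Q) \<partial>count_space G)"
      using emeasure_UN_countable[OF lebesgue_matrix_image[OF dcube_lebesgue] count disj'] by simp
    also have "\<dots> \<le> (\<integral>\<^sup>+Q. ennreal c * emeasure lebesgue (dcube Q) \<partial>count_space G)"
      by (intro nn_integral_mono cube)
    also have "\<dots> = ennreal c * (\<integral>\<^sup>+Q. emeasure lebesgue (dcube Q) \<partial>count_space G)"
      by (rule nn_integral_cmult) simp
    also have "\<dots> = ennreal c * emeasure lebesgue U"
      using emeasure_UN_countable[OF dcube_lebesgue count disj] by (simp only: eq[symmetric])
    finally show ?thesis .
  qed
  fix S :: "(real ^ 'n) set" assume S: "S \<in> sets lebesgue"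
  show "emeasure lebesgue ((*v) A ` S) \<le> ennreal c * emeasure lebesgue S"
  proof (rule ennreal_le_epsilon)
    fix e :: real assume e: "0 < e"
    \<comment> \<open>Outer regularity passes from open sets to measurable ones; c + 1 instead of c
      avoids a division by 0.\<close>
    obtain T where T: "open T" "S \<subseteq> T" "T - S \<in> lmeasurable" "emeasure lebesgue (T - S) < ennreal (e / (c + 1))"
      using sets_lebesgue_outer_open[OF S, of "e / (c + 1)"] e \<open>0 \<le> c\<close> by auto
    have "emeasure lebesgue ((*v) A ` S) \<le> emeasure lebesgue ((*v) A ` T)"
      using T S by (intro emeasure_mono lebesgue_matrix_image image_mono) auto
    also have "\<dots> \<le> ennreal c * emeasure lebesgue T" by (rule op[OF T(1)])
    also have "emeasure lebesgue T = emeasure lebesgue S + emeasure lebesgue (T - S)"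
      using T S plus_emeasure[of S lebesgue "T - S"] by (auto simp: Un_absorb1)
    also have "ennreal c * \<dots> \<le> ennreal c * emeasure lebesgue S + ennreal c * ennreal (e / (c + 1))"
      using T(4) by (simp only: distrib_left) (intro add_left_mono mult_left_mono, auto)
    also have "ennreal c * ennreal (e / (c + 1)) \<le> ennreal e"
      using e \<open>0 \<le> c\<close> by (simp add: ennreal_mult[symmetric] field_simps)
    finally show "emeasure lebesgue ((*v) A ` S) \<le> ennreal c * emeasure lebesgue S + ennreal e"
      by (simp add: add_left_mono)
  qed
qed

lemma
  fixes A :: "real ^ 'n ^ 'n"
  assumes "invertible A"
  shows matrix_inv_cancel: "A *v (matrix_inv A *v x) = x" "matrix_inv A *v (A *v x) = x"
    and vimage_matrix_inv: "(*v) (matrix_inv A) -` S = (*v) A ` S"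
    and vimage_matrix: "(*v) A -` S = (*v) (matrix_inv A) ` S"
proof -
  show c: "A *v (matrix_inv A *v x) = x" "matrix_inv A *v (A *v x) = x" for x
    using someI_ex[OF assms[unfolded invertible_def]]
    by (simp_all add: matrix_inv_def matrix_vector_mul_assoc)
  show "(*v) (matrix_inv A) -` S = (*v) A ` S" "(*v) A -` S = (*v) (matrix_inv A) ` S"
    using c by (auto simp: image_iff) metis+
qed

lemma
  fixes A :: "real ^ 'n ^ 'n"
  assumes "invertible A"
  shows measurable_matrix_lebesgue: "(*v) A \<in> measurable lebesgue lebesgue"
    and measurable_matrix_inv_lebesgue: "(*v) (matrix_inv A) \<in> measurable lebesgue lebesgue"
  using assms
  by (auto intro!: measurableI lebesgue_matrix_image simp: vimage_matrix_inv vimage_matrix)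

text \<open>The preimage of S under the inverse matrix is the image of S under A, so the
  push-forward of Lebesgue measure is dominated, as a measure, by c times Lebesgue measure.
  Integrals inherit this.\<close>

lemma nn_integral_matrix_inv_le:
  fixes A :: "real ^ 'n ^ 'n"
  assumes A: "invertible A"
  obtains c where "0 \<le> c" "\<And>h :: real ^ 'n \<Rightarrow> ennreal. h \<in> borel_measurable lebesgue \<Longrightarrow>
    (\<integral>\<^sup>+x. h (matrix_inv A *v x) \<partial>lebesgue) \<le> ennreal c * (\<integral>\<^sup>+x. h x \<partial>lebesgue)"
proof -
  have "inj ((*v) A)"
    by (rule inj_on_inverseI[of _ "(*v) (matrix_inv A)"]) (rule matrix_inv_cancel[OF A])
  then obtain c where c: "0 \<le> c"
    "\<And>S. S \<in> sets lebesgue \<Longrightarrow> emeasure lebesgue ((*v) A ` S) \<le> ennreal c * emeasure lebesgue S"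
    by (rule emeasure_matrix_image_le) blast
  note meas = measurable_matrix_inv_lebesgue[OF A]
  let ?D = "distr lebesgue lebesgue ((*v) (matrix_inv A))"
  have le: "?D \<le> scale_measure (ennreal c) lebesgue"
  proof (subst le_measure)
    show "\<forall>S\<in>sets ?D. emeasure ?D S \<le> emeasure (scale_measure (ennreal c) lebesgue) S"
      using c(2) by (auto simp: emeasure_distr[OF meas] vimage_matrix_inv[OF A])
  qed simp
  show ?thesis
  proof (rule that[OF c(1)])
    fix h :: "real ^ 'n \<Rightarrow> ennreal" assume h: "h \<in> borel_measurable lebesgue"
    have "(\<integral>\<^sup>+x. h (matrix_inv A *v x) \<partial>lebesgue) = (\<integral>\<^sup>+x. h x \<partial>?D)"
      using h by (intro nn_integral_distr[OF meas, symmetric]) simp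
    also have "\<dots> \<le> (\<integral>\<^sup>+x. h x \<partial>scale_measure (ennreal c) lebesgue)"
      by (rule nn_integral_mono_measure[OF _ le]) simp
    also have "\<dots> = ennreal c * (\<integral>\<^sup>+x. h x \<partial>lebesgue)"
      by (rule nn_integral_scale_measure[OF h])
    finally show "(\<integral>\<^sup>+x. h (matrix_inv A *v x) \<partial>lebesgue) \<le> ennreal c * (\<integral>\<^sup>+x. h x \<partial>lebesgue)" .
  qed
qed

section \<open>The two-weight inequality\<close>

text \<open>Hoelder's inequality with the bump condition, raised to the power q. Passing between
  averages over 3Q and \<open>dfrac\<close> produces the powers of 3^n and leaves s^(\<alpha> q +
  n), which the relation between the exponents turns into |Q|^(q/p).\<close>

lemma dfrac_test_condition:
  fixes f u w :: "real ^ 'n \<Rightarrow> real" and \<alpha> p q K :: real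
  assumes \<phi>: "young \<phi>" and meas: "f \<in> borel_measurable lebesgue" "w \<in> borel_measurable lebesgue"
    and pos: "AE x in lebesgue. 0 < w x" and K: "0 < K"
    and pq: "0 < p" "0 < q" "1 / q = 1 / p - \<alpha> / CARD('n)"
    and bump: "Lr_avg q u (dcube3 Q) * Luxemburg_avg \<phi> (\<lambda>x. 1 / w x) (dcube3 Q) \<le> ennreal K"
  shows "epowr (dfrac \<alpha> f Q) q * (\<integral>\<^sup>+x\<in>dcube3 Q. ennreal (\<bar>u x\<bar> powr q) \<partial>lebesgue)
    \<le> ennreal ((2 * K * 3 ^ CARD('n)) powr q * 3 ^ CARD('n)) *
      epowr (emeasure lebesgue (dcube Q) * epowr (dlux (complementary \<phi>) (\<lambda>x. \<bar>f x * w x\<bar>) Q) p) (q / p)"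
proof -
  let ?n = "real CARD('n)"
  define s where "s = dside (fst Q)"
  have s: "0 < s" by (simp add: s_def)
  define N where "N = dlux (complementary \<phi>) (\<lambda>x. \<bar>f x * w x\<bar>) Q"
  define I where "I = (\<integral>\<^sup>+x\<in>dcube Q. ennreal \<bar>f x\<bar> \<partial>lebesgue)"
  define W where "W = (\<integral>\<^sup>+x\<in>dcube3 Q. ennreal (\<bar>u x\<bar> powr q) \<partial>lebesgue)"
  define t where "t = 3 ^ CARD('n) * s powr ?n"
  have t: "0 < t" using s by (simp add: t_def)
  have V: "emeasure lebesgue (dcube3 Q) = ennreal t"
    unfolding emeasure_dcube3 t_def s_def[symmetric] using s by (simp add: powr_realpow)
  have "I / ennreal t * epowr (W / ennreal t) (1 / q) \<le> N * ennreal (2 * K)"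
    using avg_mult_Lr_avg_le_dlux[OF \<phi> meas pos K bump]
    by (simp only: V Lr_avg_def cube_avg_def I_def W_def N_def)
  then have "epowr (I / ennreal t * epowr (W / ennreal t) (1 / q)) q \<le> epowr (N * ennreal (2 * K)) q"
    using pq by (intro epowr_mono) auto
  then have main: "epowr (I / ennreal t) q * (W / ennreal t) \<le> epowr N q * ennreal ((2 * K) powr q)"
    using pq(1,2) K by (simp add: epowr_mult epowr_ennreal)
  have cancel: "X = X / ennreal t * ennreal t" for X
    using t by (simp add: ennreal_divide_times)
  have "dfrac \<alpha> f Q = ennreal (s powr (\<alpha> - ?n)) * I"
    by (simp add: dfrac_def s_def I_def)
  also have "\<dots> = ennreal (s powr (\<alpha> - ?n)) * (I / ennreal t * ennreal t)"
    by (simp only: cancel[symmetric])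
  also have "\<dots> = ennreal (3 ^ CARD('n) * s powr \<alpha>) * (I / ennreal t)"
  proof -
    have "s powr (\<alpha> - ?n) * t = 3 ^ CARD('n) * s powr \<alpha>"
      using powr_add[of s "\<alpha> - ?n" ?n] by (simp add: t_def mult_ac)
    then have eq: "ennreal (s powr (\<alpha> - ?n)) * ennreal t = ennreal (3 ^ CARD('n) * s powr \<alpha>)"
      using t by (simp add: ennreal_mult''[symmetric])
    show ?thesis unfolding eq[symmetric] by (simp only: mult_ac)
  qed
  finally have "epowr (dfrac \<alpha> f Q) q = ennreal ((3 ^ CARD('n) * s powr \<alpha>) powr q) * epowr (I / ennreal t) q"
    using pq s by (simp add: epowr_mult epowr_ennreal)
  then have "epowr (dfrac \<alpha> f Q) q * W
      = ennreal ((3 ^ CARD('n) * s powr \<alpha>) powr q) * ennreal t * (epowr (I / ennreal t) q * (W / ennreal t))"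
    by (subst cancel[of W]) (simp only: mult_ac)
  also have "\<dots> \<le> ennreal ((3 ^ CARD('n) * s powr \<alpha>) powr q) * ennreal t * (epowr N q * ennreal ((2 * K) powr q))"
    by (rule mult_left_mono[OF main]) simp
  also have "\<dots> = ennreal ((3 ^ CARD('n) * s powr \<alpha>) powr q * t * (2 * K) powr q) * epowr N q"
    using t by (simp add: ennreal_mult mult_ac)
  also have "(3 ^ CARD('n) * s powr \<alpha>) powr q * t * (2 * K) powr q
      = (2 * K * 3 ^ CARD('n)) powr q * 3 ^ CARD('n) * (s ^ CARD('n)) powr (q / p)"
  proof -
    have "\<alpha> * q + ?n = ?n * (q / p)"
      using pq by (simp add: field_simps)
    then have "s powr (\<alpha> * q) * s powr ?n = (s ^ CARD('n)) powr (q / p)"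
      using s by (simp add: powr_add[symmetric] powr_powr powr_realpow[symmetric])
    then show ?thesis
      using s K by (simp add: t_def powr_mult powr_powr)
  qed
  also have "ennreal ((2 * K * 3 ^ CARD('n)) powr q * 3 ^ CARD('n) * (s ^ CARD('n)) powr (q / p)) * epowr N q
      = ennreal ((2 * K * 3 ^ CARD('n)) powr q * 3 ^ CARD('n)) * epowr (emeasure lebesgue (dcube Q) * epowr N p) (q / p)"
    unfolding emeasure_dcube s_def[symmetric]
    using pq s K by (simp add: epowr_mult epowr_ennreal epowr_epowr ennreal_mult mult_ac)
  finally show ?thesis by (simp only: W_def N_def)
qed

section \<open>Reduction to integrable functions by truncation\<close>

text \<open>Cutting off both the values and the support makes every measurable function integrable,
  while the absolute values still increase to |f|.\<close>

definition trunc :: "(real ^ 'n \<Rightarrow> real) \<Rightarrow> nat \<Rightarrow> real ^ 'n \<Rightarrow> real" where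
  "trunc f m x = (if \<bar>f x\<bar> \<le> real m \<and> norm x \<le> real m then f x else 0)"

lemma measurable_trunc [measurable]:
  assumes [measurable]: "f \<in> borel_measurable lebesgue"
  shows "trunc f m \<in> borel_measurable lebesgue"
proof -
  have [measurable]: "(\<lambda>x :: real ^ 'n. norm x) \<in> borel_measurable lebesgue"
    by (rule measurable_completion) measurable
  show ?thesis unfolding trunc_def[abs_def] by measurable
qed

lemma abs_trunc_le: "\<bar>trunc f m x\<bar> \<le> \<bar>f x\<bar>"
  by (simp add: trunc_def)

lemma incseq_trunc: "incseq (\<lambda>m x. ennreal \<bar>trunc f m x\<bar>)"
  by (intro incseq_SucI le_funI) (auto simp: trunc_def)

lemma SUP_trunc: "(SUP m. ennreal \<bar>trunc f m x\<bar>) = ennreal \<bar>f x\<bar>"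
proof (rule antisym)
  obtain m :: nat where "max \<bar>f x\<bar> (norm x) \<le> real m"
    using real_arch_simple by blast
  then have "\<bar>trunc f m x\<bar> = \<bar>f x\<bar>" by (simp add: trunc_def)
  then show "ennreal \<bar>f x\<bar> \<le> (SUP m. ennreal \<bar>trunc f m x\<bar>)"
    by (intro SUP_upper2[of m]) auto
qed (intro SUP_least ennreal_leI abs_trunc_le)

lemma trunc_integral_finite:
  fixes f :: "real ^ 'n \<Rightarrow> real"
  shows "(\<integral>\<^sup>+x. ennreal \<bar>trunc f m x\<bar> \<partial>lebesgue) < top"
proof -
  have "(\<integral>\<^sup>+x. ennreal \<bar>trunc f m x\<bar> \<partial>lebesgue)
      \<le> (\<integral>\<^sup>+x. ennreal (real m) * indicator (cball (0 :: real ^ 'n) m) x \<partial>lebesgue)"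
    by (intro nn_integral_mono) (auto simp: trunc_def indicator_def)
  also have "\<dots> = ennreal (real m) * emeasure lebesgue (cball (0 :: real ^ 'n) m)"
    by (rule nn_integral_cmult_indicator) simp
  also have "\<dots> < top"
    using fmeasurableD2[OF lmeasurable_cball[of "0 :: real ^ 'n" "real m"]]
    unfolding ennreal_mult_less_top less_top by simp
  finally show ?thesis .
qed

lemma dfrac_SUP_trunc:
  assumes [measurable]: "f \<in> borel_measurable lebesgue"
  shows "dfrac \<alpha> f Q = (SUP m. dfrac \<alpha> (trunc f m) Q)"
proof -
  have "(\<integral>\<^sup>+x\<in>dcube Q. ennreal \<bar>f x\<bar> \<partial>lebesgue)
      = (\<integral>\<^sup>+x. (SUP m. ennreal \<bar>trunc f m x\<bar> * indicator (dcube Q) x) \<partial>lebesgue)"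
    by (simp only: SUP_mult_right_ennreal[symmetric] SUP_trunc)
  also have "\<dots> = (SUP m. \<integral>\<^sup>+x\<in>dcube Q. ennreal \<bar>trunc f m x\<bar> \<partial>lebesgue)"
  proof (rule nn_integral_monotone_convergence_SUP)
    show "incseq (\<lambda>m x. ennreal \<bar>trunc f m x\<bar> * indicator (dcube Q) x)"
      using incseq_trunc[of f] by (auto simp: incseq_def le_fun_def intro!: mult_right_mono)
  qed measurable
  finally show ?thesis
    by (simp only: dfrac_def SUP_mult_left_ennreal)
qed

lemma dfrac_max_SUP_trunc:
  assumes "f \<in> borel_measurable lebesgue"
  shows "dfrac_max \<alpha> f x = (SUP m. dfrac_max \<alpha> (trunc f m) x)"
  unfolding dfrac_max_def dfrac_SUP_trunc[OF assms] SUP_mult_right_ennreal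
  by (rule SUP_commute)

lemma incseq_dfrac_max_trunc: "incseq (\<lambda>m. dfrac_max \<alpha> (trunc f m))"
proof -
  have "dfrac \<alpha> (trunc f m) Q \<le> dfrac \<alpha> (trunc f n) Q" if "m \<le> n" for m n Q
    unfolding dfrac_def using incseq_trunc[of f] that
    by (intro mult_left_mono nn_integral_mono mult_right_mono) (auto simp: incseq_def le_fun_def)
  then show ?thesis
    unfolding incseq_def le_fun_def dfrac_max_def by (blast intro: SUP_mono' mult_right_mono zero_le)
qed

lemma two_weight_dfrac_max:
  fixes u w :: "real ^ 'n \<Rightarrow> real" and \<alpha> p q K :: real
  assumes \<phi>: "young \<phi>" "complementary \<phi> \<in> B_class p"
    and [measurable]: "w \<in> borel_measurable lebesgue" "u \<in> borel_measurable lebesgue"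
    and pos: "AE x in lebesgue. 0 < w x"
    and \<alpha>: "0 < \<alpha>" "\<alpha> < CARD('n)"
    and pq: "1 < p" "1 < q" "1 / q = 1 / p - \<alpha> / CARD('n)"
    and bump: "\<And>Q. Lr_avg q u (dcube3 Q) * Luxemburg_avg \<phi> (\<lambda>x. 1 / w x) (dcube3 Q) \<le> ennreal K"
  obtains C where "0 \<le> C" "\<And>f. f \<in> borel_measurable lebesgue \<Longrightarrow>
    (\<integral>\<^sup>+x. epowr (dfrac_max \<alpha> f x) q * ennreal (\<bar>u x\<bar> powr q) \<partial>lebesgue)
      \<le> ennreal C * epowr (\<integral>\<^sup>+x. ennreal (\<bar>f x * w x\<bar> powr p) \<partial>lebesgue) (q / p)"
proof -
  \<comment> \<open>Enlarged so that the constant is positive, as the division by it in the Hoelder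
    step requires.\<close>
  define K' where "K' = max 1 K"
  have K': "0 < K'" by (simp add: K'_def)
  have bump': "Lr_avg q u (dcube3 Q) * Luxemburg_avg \<phi> (\<lambda>x. 1 / w x) (dcube3 Q) \<le> ennreal K'" for Q
    using bump[of Q] by (rule order_trans) (simp add: K'_def ennreal_leI)
  have "1 / q < 1 / p" using pq(3) \<alpha> by (simp add: divide_pos_pos)
  then have "p \<le> q" using pq(1,2) by (simp add: field_simps)
  define \<Phi> where "\<Phi> = complementary \<phi>"
  have mono: "mono \<Phi>" and [measurable]: "\<Phi> \<in> borel_measurable borel"
    unfolding \<Phi>_def by (rule mono_complementary measurable_complementary)+
  obtain J :: nat where J: "\<Phi> (2 powr (- real J)) \<le> ennreal (1 / 2)"
    using complementary_small[OF \<phi>] pq unfolding \<Phi>_def by auto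
  define D where "D = (\<integral>\<^sup>+j. ennreal (2 powr (- (real j * p))) * \<Phi> (2 powr (real j + 1)) \<partial>count_space (UNIV :: nat set))"
  have "D < top"
    unfolding D_def using \<phi>(2) pq by (intro B_class_dyadic_sum[OF mono]) (auto simp: \<Phi>_def)
  then obtain d where d: "D = ennreal d" "0 \<le> d"
    by (cases D rule: ennreal_cases) auto
  \<comment> \<open>The outer 2 is the loss from sparseness; the rest is the strong type constant of
    the dyadic Luxemburg maximal function.\<close>
  define B where "B = 2 * (2 * 2 powr ((real J + 1) * p) * d)"
  have B: "0 \<le> B" using d by (simp add: B_def)
  define C1 where "C1 = (2 * K' * 3 ^ CARD('n)) powr q * 3 ^ CARD('n)"
  define C where "C = 2 powr ((CARD('n) + 1) * q) * C1 * B powr (q / p)"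
  have C1: "0 \<le> C1" by (simp add: C1_def)
  \<comment> \<open>C was fixed before \<open>f\<close>, so this bound is uniform over all
    truncations of a given function.\<close>
  have integrable: "(\<integral>\<^sup>+x. epowr (dfrac_max \<alpha> f x) q * ennreal (\<bar>u x\<bar> powr q) \<partial>lebesgue)
      \<le> ennreal C * epowr (\<integral>\<^sup>+x. ennreal (\<bar>f x * w x\<bar> powr p) \<partial>lebesgue) (q / p)"
    if f [measurable]: "f \<in> borel_measurable lebesgue" and fin: "(\<integral>\<^sup>+x. ennreal \<bar>f x\<bar> \<partial>lebesgue) < top" for f
  proof -
    define g where "g x = \<bar>f x * w x\<bar>" for x
    have [measurable]: "g \<in> borel_measurable lebesgue"
      unfolding g_def by measurable
    have "(\<integral>\<^sup>+x. epowr (dfrac_max \<alpha> f x) q * ennreal (\<bar>u x\<bar> powr q) \<partial>lebesgue)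
      \<le> ennreal (2 powr ((CARD('n) + 1) * q)) * ennreal C1 * epowr (2 * (\<integral>\<^sup>+x. epowr (dlux_max \<Phi> g x) p \<partial>lebesgue)) (q / p)"
    proof (rule nn_integral_dfrac_max_le_integrable[OF f fin \<alpha> _ \<open>p \<le> q\<close>, where N = "dlux \<Phi> g"])
      show "epowr (dfrac \<alpha> f Q) q * (\<integral>\<^sup>+x\<in>dcube3 Q. ennreal (\<bar>u x\<bar> powr q) \<partial>lebesgue)
        \<le> ennreal C1 * epowr (emeasure lebesgue (dcube Q) * epowr (dlux \<Phi> g Q) p) (q / p)" for Q
        unfolding C1_def \<Phi>_def g_def
        using pq by (intro dfrac_test_condition[OF \<phi>(1) f _ pos K' _ _ _ bump']) auto
    qed (use pq dlux_le_max in auto)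
    also have "\<dots> \<le> ennreal (2 powr ((CARD('n) + 1) * q)) * ennreal C1 *
        epowr (ennreal B * (\<integral>\<^sup>+x. ennreal (g x powr p) \<partial>lebesgue)) (q / p)"
    proof (intro mult_left_mono epowr_mono)
      have "(\<integral>\<^sup>+x. epowr (dlux_max \<Phi> g x) p \<partial>lebesgue)
          \<le> ennreal (2 * 2 powr ((real J + 1) * p)) * D * (\<integral>\<^sup>+x. ennreal (g x powr p) \<partial>lebesgue)"
        unfolding D_def using pq
        by (intro strong_type_dlux_max[OF _ _ _ mono J]) (auto simp: g_def)
      then have "2 * (\<integral>\<^sup>+x. epowr (dlux_max \<Phi> g x) p \<partial>lebesgue)
          \<le> 2 * (ennreal (2 * 2 powr ((real J + 1) * p)) * D * (\<integral>\<^sup>+x. ennreal (g x powr p) \<partial>lebesgue))"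
        by (rule mult_left_mono) simp
      also have "\<dots> = ennreal B * (\<integral>\<^sup>+x. ennreal (g x powr p) \<partial>lebesgue)"
        unfolding B_def d(1) using d(2)
        by (simp add: ennreal_mult mult.assoc)
      finally show "2 * (\<integral>\<^sup>+x. epowr (dlux_max \<Phi> g x) p \<partial>lebesgue)
        \<le> ennreal B * (\<integral>\<^sup>+x. ennreal (g x powr p) \<partial>lebesgue)" .
    qed (use pq in auto)
    also have "\<dots> = ennreal C * epowr (\<integral>\<^sup>+x. ennreal (g x powr p) \<partial>lebesgue) (q / p)"
      using pq B C1 by (simp add: epowr_mult epowr_ennreal C_def ennreal_mult mult.assoc)
    finally show ?thesis by (simp only: g_def)
  qed
  show ?thesis
  proof (rule that[of C])
    show "0 \<le> C" using C1 by (simp add: C_def)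
    fix f :: "real ^ 'n \<Rightarrow> real" assume f [measurable]: "f \<in> borel_measurable lebesgue"
    have "(\<integral>\<^sup>+x. epowr (dfrac_max \<alpha> f x) q * ennreal (\<bar>u x\<bar> powr q) \<partial>lebesgue)
        = (\<integral>\<^sup>+x. (SUP m. epowr (dfrac_max \<alpha> (trunc f m) x) q * ennreal (\<bar>u x\<bar> powr q)) \<partial>lebesgue)"
      using pq by (simp only: dfrac_max_SUP_trunc[OF f] SUP_mult_right_ennreal[symmetric] epowr_SUP)
    also have "\<dots> = (SUP m. \<integral>\<^sup>+x. epowr (dfrac_max \<alpha> (trunc f m) x) q * ennreal (\<bar>u x\<bar> powr q) \<partial>lebesgue)"
    proof (rule nn_integral_monotone_convergence_SUP)
      show "incseq (\<lambda>m x. epowr (dfrac_max \<alpha> (trunc f m) x) q * ennreal (\<bar>u x\<bar> powr q))"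
        using incseq_dfrac_max_trunc[of \<alpha> f] pq
        by (auto simp: incseq_def le_fun_def intro!: mult_right_mono epowr_mono)
    qed measurable
    also have "\<dots> \<le> ennreal C * epowr (\<integral>\<^sup>+x. ennreal (\<bar>f x * w x\<bar> powr p) \<partial>lebesgue) (q / p)"
    proof (rule SUP_least)
      fix m
      have "(\<integral>\<^sup>+x. epowr (dfrac_max \<alpha> (trunc f m) x) q * ennreal (\<bar>u x\<bar> powr q) \<partial>lebesgue)
          \<le> ennreal C * epowr (\<integral>\<^sup>+x. ennreal (\<bar>trunc f m x * w x\<bar> powr p) \<partial>lebesgue) (q / p)"
        by (rule integrable) (auto simp: trunc_integral_finite)
      also have "\<dots> \<le> ennreal C * epowr (\<integral>\<^sup>+x. ennreal (\<bar>f x * w x\<bar> powr p) \<partial>lebesgue) (q / p)"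
        using pq by (intro mult_left_mono epowr_mono nn_integral_mono ennreal_leI powr_mono2)
          (auto simp: abs_mult intro!: mult_right_mono abs_trunc_le)
      finally show "(\<integral>\<^sup>+x. epowr (dfrac_max \<alpha> (trunc f m) x) q * ennreal (\<bar>u x\<bar> powr q) \<partial>lebesgue)
        \<le> ennreal C * epowr (\<integral>\<^sup>+x. ennreal (\<bar>f x * w x\<bar> powr p) \<partial>lebesgue) (q / p)" .
    qed
    finally show "(\<integral>\<^sup>+x. epowr (dfrac_max \<alpha> f x) q * ennreal (\<bar>u x\<bar> powr q) \<partial>lebesgue)
      \<le> ennreal C * epowr (\<integral>\<^sup>+x. ennreal (\<bar>f x * w x\<bar> powr p) \<partial>lebesgue) (q / p)" .
  qed
qed

section \<open>Transfer to the matrix operator\<close>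

text \<open>Local integrability gives measurability of the restrictions to balls, and the function
  is their pointwise limit.\<close>

lemma weight_measurable:
  fixes w :: "real ^ 'n \<Rightarrow> real"
  assumes "weight w"
  shows "w \<in> borel_measurable lebesgue"
proof -
  have meas: "(\<lambda>x. indicator (cball 0 (real m)) x *\<^sub>R w x) \<in> borel_measurable lebesgue" for m :: nat
    using assms unfolding weight_def absolutely_integrable_on_def set_integrable_def
    by (intro borel_measurable_integrable) auto
  have "(\<lambda>m. indicator (cball 0 (real m)) x *\<^sub>R w x) \<longlonglongrightarrow> w x" for x
  proof (rule tendsto_eventually)
    obtain m0 :: nat where "norm x \<le> real m0" using real_arch_simple by blast
    then show "\<forall>\<^sub>F m in sequentially. indicator (cball 0 (real m)) x *\<^sub>R w x = w x"
      unfolding eventually_sequentially by (intro exI[of _ m0]) (auto simp: indicator_def)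
  qed
  then show ?thesis
    by (rule borel_measurable_LIMSEQ_real[OF _ meas])
qed

theorem theorem1p9:
  fixes A :: "real ^ 'n ^ 'n" and \<alpha> p q :: real
    and \<phi> :: "real \<Rightarrow> real" and w :: "real ^ 'n \<Rightarrow> real"
  assumes "invertible A"
    and "0 < \<alpha>" and "\<alpha> < CARD('n)"
    and "1 < p" and "1 < q" and "1 / q = 1 / p - \<alpha> / CARD('n)"
    and "young \<phi>" and "complementary \<phi> \<in> B_class p"
    and "w \<in> bump_class A q \<phi>"
  shows "\<exists>C::real. 0 \<le> C \<and>
    (\<forall>f \<in> weighted_Lp p (\<lambda>x. w x powr p).
       weighted_norm q (\<lambda>x. w x powr q) (frac_maximal_mat \<alpha> (matrix_inv A) f)
         \<le> ennreal C * weighted_norm p (\<lambda>x. w x powr p) (\<lambda>x. ennreal \<bar>f x\<bar>))"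
proof -
  note A = assms(1) and \<alpha> = assms(2,3) and pq = assms(4-6)
  have weight: "weight w" and bump_fin: "bump_const A q \<phi> w < top"
    using assms(9) by (auto simp: bump_class_def)
  have w_meas [measurable]: "w \<in> borel_measurable lebesgue"
    by (rule weight_measurable[OF weight])
  have pos: "AE x in lebesgue. 0 < w x"
    using weight by (simp add: weight_def)
  \<comment> \<open>With y = A^(-1) x one has w x = u y, so the whole left-hand integrand becomes a
    function of A^(-1) x. The bump condition is exactly the testing condition for the pair u,
    w.\<close>
  define u where "u y = w (A *v y)" for y
  have u_meas [measurable]: "u \<in> borel_measurable lebesgue"
    unfolding u_def by (rule measurable_compose[OF measurable_matrix_lebesgue[OF A] w_meas])
  obtain K where K: "bump_const A q \<phi> w = ennreal K"
    using bump_fin by (cases "bump_const A q \<phi> w" rule: ennreal_cases) auto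
  have bump: "Lr_avg q u (dcube3 Q) * Luxemburg_avg \<phi> (\<lambda>x. 1 / w x) (dcube3 Q) \<le> ennreal K" for Q
    unfolding K[symmetric] bump_const_def u_def by (rule SUP_upper[OF dcube3_cubes])
  obtain C1 where C1: "0 \<le> C1" "\<And>f. f \<in> borel_measurable lebesgue \<Longrightarrow>
    (\<integral>\<^sup>+x. epowr (dfrac_max \<alpha> f x) q * ennreal (\<bar>u x\<bar> powr q) \<partial>lebesgue)
      \<le> ennreal C1 * epowr (\<integral>\<^sup>+x. ennreal (\<bar>f x * w x\<bar> powr p) \<partial>lebesgue) (q / p)"
    using two_weight_dfrac_max[OF assms(7,8) w_meas u_meas pos \<alpha> pq bump] by blast
  obtain c where c: "0 \<le> c" "\<And>h :: real ^ 'n \<Rightarrow> ennreal. h \<in> borel_measurable lebesgue \<Longrightarrow>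
    (\<integral>\<^sup>+x. h (matrix_inv A *v x) \<partial>lebesgue) \<le> ennreal c * (\<integral>\<^sup>+x. h x \<partial>lebesgue)"
    using nn_integral_matrix_inv_le[OF A] by blast
  define b where "b = 2 ^ CARD('n) * 2 powr (CARD('n) - \<alpha>)"
  have b: "0 \<le> b" by (simp add: b_def)
  define C where "C = (c * (b powr q * C1)) powr (1 / q)"
  show ?thesis
  proof (intro exI[of _ C] conjI ballI)
    show "0 \<le> C" by (simp add: C_def)
    fix f assume "f \<in> weighted_Lp p (\<lambda>x. w x powr p)"
    then have f [measurable]: "f \<in> borel_measurable lebesgue"
      by (simp add: weighted_Lp_def)
    define I where "I = (\<integral>\<^sup>+x. ennreal (\<bar>f x * w x\<bar> powr p) \<partial>lebesgue)"
    define h where "h y = ennreal (b powr q) * (epowr (dfrac_max \<alpha> f y) q * ennreal (\<bar>u y\<bar> powr q))" for y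
    have h_meas: "h \<in> borel_measurable lebesgue"
      unfolding h_def by measurable
    \<comment> \<open>Only an almost everywhere comparison is available: \<open>h\<close> contains
      the absolute value of u, which agrees with w x where the weight is positive.\<close>
    have "(\<integral>\<^sup>+x. epowr (frac_maximal_mat \<alpha> (matrix_inv A) f x) q * ennreal (w x powr q) \<partial>lebesgue)
        \<le> (\<integral>\<^sup>+x. h (matrix_inv A *v x) \<partial>lebesgue)"
    proof (rule nn_integral_mono_AE)
      show "AE x in lebesgue. epowr (frac_maximal_mat \<alpha> (matrix_inv A) f x) q * ennreal (w x powr q)
        \<le> h (matrix_inv A *v x)"
        using pos
      proof eventually_elim
        fix x assume w: "0 < w x"
        let ?y = "matrix_inv A *v x"
        have "frac_maximal_mat \<alpha> (matrix_inv A) f x \<le> ennreal b * dfrac_max \<alpha> f ?y"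
          unfolding frac_maximal_mat_def b_def by (rule frac_maximal_le_dfrac_max[OF f \<alpha>(2)])
        then have "epowr (frac_maximal_mat \<alpha> (matrix_inv A) f x) q \<le> epowr (ennreal b * dfrac_max \<alpha> f ?y) q"
          using pq by (intro epowr_mono) auto
        also have "\<dots> = ennreal (b powr q) * epowr (dfrac_max \<alpha> f ?y) q"
          using pq b by (simp add: epowr_mult epowr_ennreal)
        finally have "epowr (frac_maximal_mat \<alpha> (matrix_inv A) f x) q * ennreal (w x powr q)
            \<le> ennreal (b powr q) * epowr (dfrac_max \<alpha> f ?y) q * ennreal (w x powr q)"
          by (rule mult_right_mono) simp
        also have "\<dots> = h ?y"
          using w by (simp add: h_def u_def matrix_inv_cancel[OF A] mult.assoc)
        finally show "epowr (frac_maximal_mat \<alpha> (matrix_inv A) f x) q * ennreal (w x powr q) \<le> h ?y" .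
      qed
    qed
    also have "\<dots> \<le> ennreal c * (\<integral>\<^sup>+y. h y \<partial>lebesgue)"
      by (rule c(2)[OF h_meas])
    also have "(\<integral>\<^sup>+y. h y \<partial>lebesgue)
        = ennreal (b powr q) * (\<integral>\<^sup>+y. epowr (dfrac_max \<alpha> f y) q * ennreal (\<bar>u y\<bar> powr q) \<partial>lebesgue)"
      unfolding h_def by (rule nn_integral_cmult) measurable
    also have "ennreal c * \<dots> \<le> ennreal c * (ennreal (b powr q) * (ennreal C1 * epowr I (q / p)))"
      unfolding I_def by (intro mult_left_mono C1(2) f) auto
    also have "\<dots> = ennreal (c * (b powr q * C1)) * epowr I (q / p)"
      using c(1) C1(1) by (simp add: ennreal_mult mult.assoc)
    finally have "weighted_norm q (\<lambda>x. w x powr q) (frac_maximal_mat \<alpha> (matrix_inv A) f)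
        \<le> epowr (ennreal (c * (b powr q * C1)) * epowr I (q / p)) (1 / q)"
      unfolding weighted_norm_def using pq(2) by (intro epowr_mono) auto
    also have "\<dots> = ennreal C * epowr I (1 / p)"
      using pq(1,2) c(1) C1(1) by (simp add: epowr_mult epowr_ennreal epowr_epowr C_def)
    also have "epowr I (1 / p) = weighted_norm p (\<lambda>x. w x powr p) (\<lambda>x. ennreal \<bar>f x\<bar>)"
    proof -
      have "I = (\<integral>\<^sup>+x. epowr (ennreal \<bar>f x\<bar>) p * ennreal (w x powr p) \<partial>lebesgue)"
        unfolding I_def
      proof (rule nn_integral_cong_AE)
        show "AE x in lebesgue. ennreal (\<bar>f x * w x\<bar> powr p) = epowr (ennreal \<bar>f x\<bar>) p * ennreal (w x powr p)"
          using pos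
          by eventually_elim (simp add: epowr_ennreal ennreal_mult[symmetric] abs_mult powr_mult)
      qed
      then show ?thesis by (simp add: weighted_norm_def)
    qed
    finally show "weighted_norm q (\<lambda>x. w x powr q) (frac_maximal_mat \<alpha> (matrix_inv A) f)
      \<le> ennreal C * weighted_norm p (\<lambda>x. w x powr p) (\<lambda>x. ennreal \<bar>f x\<bar>)" .
  qed
qed

end
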